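(* For every $n\ge1$, the labeling $\lambda_E$ is an EW-labeling of the poset of weighted partitions $\Pi_n^w$, and hence $Q_{\lambda_E}(\Pi_n^w)$ is a Whitney dual of $\Pi_n^w$.
   Context: Weighted partitions: a weighted partition of $[n]$ is a set partition $B_1/\cdots/B_t$ of $[n]$ with weights $v_i\in\{0,\dots,|B_i|-1\}$, written $B_1^{v_1}/\cdots/B_t^{v_t}$. $\Pi_n^w$ has cover relations $A_1^{w_1}/\cdots/A_s^{w_s}\lessdot B_1^{v_1}/\cdots/B_{s-1}^{v_{s-1}}$ iff the second partition is obtained from the first by merging two blocks $A_i,A_j$ into $B_k=A_i\cup A_j$ with $v_k-(w_i+w_j)\in\{0,1\}$, all other blocks and weights unchanged. For a cover where blocks $A^{w_A}$, $B^{w_B}$ with $\min A<\min B$ merge into $(A\cup B)^{w_A+w_B+u}$, $u\in\{0,1\}$, set $\lambda_E=(\min A,\min B)^u$. The label poset is $\Lambda_n=\Gamma_1\oplus\cdots\oplus\Gamma_n$ (ordinal sum), where $\Gamma_a=\{(a,b)^u: a<b\le n+1,\ u\in\{0,1\}\}$ ordered by $(a,b)^u\le(a,c)^v$ iff $b\le c$ and $u\le v$. E-labelings: words of labels read bottom to top; increasing = strictly increasing; ascent-free = no consecutive $a<b$. ER-labeling: every closed interval has exactly one increasing maximal chain. Rank two switching property: for every saturated chain $\hat0=x_0\lessdot\cdots\lessdot x_k$ and $i$ with $\lambda(x_{i-1}\lessdot x_i)<\lambda(x_i\lessdot x_{i+1})$ there is a unique $x_i'$ with $x_{i-1}\lessdot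 x_i'\lessdot x_{i+1}$, $\lambda(x_{i-1}\lessdot x_i')=\lambda(x_i\lessdot x_{i+1})$, $\lambda(x_i'\lessdot x_{i+1})=\lambda(x_{i-1}\lessdot x_i)$. EW-labeling: ER-labeling with the rank two switching property such that in each interval distinct maximal chains have distinct label words. $Q_\lambda(P)$: $C(P)$ is the set of saturated chains from $\hat0$ ordered by inclusion; $\mathbf c_1\sim_\lambda\mathbf c_2$ iff they end at the same $y$ and are connected by quadratic exchanges (replacing $x_i$ by $x_i'$ at an ascent, forwards or backwards) among maximal chains of $[\hat0,y]$; $Q_\lambda(P)$ is the set of classes ordered by the transitive closure of: $X\le Y$ if some $\mathbf c\in X$, $\mathbf d\in Y$ have $\mathbf c\subseteq\mathbf d$. Whitney numbers: $w_k(P)=\sum_{\rho(x)=k}\mu(\hat0,x)$, $W_k(P)=|\{x:\rho(x)=k\}|$; Whitney duals: $|w_k(P)|=W_k(Q)$, $|w_k(Q)|=W_k(P)$ for all $k$. *)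

theory Defs
  imports Main
begin

definition strict :: "('a \<Rightarrow> 'a \<Rightarrow> bool) \<Rightarrow> 'a \<Rightarrow> 'a \<Rightarrow> bool" where
  "strict le x y \<longleftrightarrow> le x y \<and> x \<noteq> y"

definition partial_order_on :: "'a set \<Rightarrow> ('a \<Rightarrow> 'a \<Rightarrow> bool) \<Rightarrow> bool" where
  "partial_order_on P le \<longleftrightarrow>
     (\<forall>x\<in>P. le x x) \<and>
     (\<forall>x\<in>P. \<forall>y\<in>P. le x y \<and> le y x \<longrightarrow> x = y) \<and>
     (\<forall>x\<in>P. \<forall>y\<in>P. \<forall>z\<in>P. le x y \<and> le y z \<longrightarrow> le x z)"

definition covers :: "'a set \<Rightarrow> ('a \<Rightarrow> 'a \<Rightarrow> bool) \<Rightarrow> 'a \<Rightarrow> 'a \<Rightarrow> bool" where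
  "covers P le x y \<longleftrightarrow> x \<in> P \<and> y \<in> P \<and> strict le x y \<and>
     \<not> (\<exists>z\<in>P. strict le x z \<and> strict le z y)"

definition satchain :: "'a set \<Rightarrow> ('a \<Rightarrow> 'a \<Rightarrow> bool) \<Rightarrow> 'a \<Rightarrow> 'a \<Rightarrow> 'a list \<Rightarrow> bool" where
  "satchain P le x y cs \<longleftrightarrow> cs \<noteq> [] \<and> hd cs = x \<and> last cs = y \<and> set cs \<subseteq> P \<and>
     successively (covers P le) cs"

definition lword :: "('a \<Rightarrow> 'a \<Rightarrow> 'l) \<Rightarrow> 'a list \<Rightarrow> 'l list" where
  "lword lam cs = map (\<lambda>(a, b). lam a b) (zip cs (tl cs))"

definition ER_labeling :: "'a set \<Rightarrow> ('a \<Rightarrow> 'a \<Rightarrow> bool) \<Rightarrow> ('a \<Rightarrow> 'a \<Rightarrow> 'l)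
    \<Rightarrow> ('l \<Rightarrow> 'l \<Rightarrow> bool) \<Rightarrow> bool" where
  "ER_labeling P le lam llt \<longleftrightarrow>
     (\<forall>x\<in>P. \<forall>y\<in>P. le x y \<longrightarrow>
        (\<exists>!cs. satchain P le x y cs \<and> successively llt (lword lam cs)))"

definition rank_two_switching :: "'a set \<Rightarrow> ('a \<Rightarrow> 'a \<Rightarrow> bool) \<Rightarrow> 'a \<Rightarrow> ('a \<Rightarrow> 'a \<Rightarrow> 'l)
    \<Rightarrow> ('l \<Rightarrow> 'l \<Rightarrow> bool) \<Rightarrow> bool" where
  "rank_two_switching P le z0 lam llt \<longleftrightarrow>
     (\<forall>cs y i. satchain P le z0 y cs \<longrightarrow> 0 < i \<longrightarrow> Suc i < length cs \<longrightarrow>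
        llt (lam (cs ! (i - 1)) (cs ! i)) (lam (cs ! i) (cs ! Suc i)) \<longrightarrow>
        (\<exists>!x'. covers P le (cs ! (i - 1)) x' \<and> covers P le x' (cs ! Suc i) \<and>
               lam (cs ! (i - 1)) x' = lam (cs ! i) (cs ! Suc i) \<and>
               lam x' (cs ! Suc i) = lam (cs ! (i - 1)) (cs ! i)))"

definition EW_labeling :: "'a set \<Rightarrow> ('a \<Rightarrow> 'a \<Rightarrow> bool) \<Rightarrow> 'a \<Rightarrow> ('a \<Rightarrow> 'a \<Rightarrow> 'l)
    \<Rightarrow> ('l \<Rightarrow> 'l \<Rightarrow> bool) \<Rightarrow> bool" where
  "EW_labeling P le z0 lam llt \<longleftrightarrow>
     ER_labeling P le lam llt \<and> rank_two_switching P le z0 lam llt \<and>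
     (\<forall>x\<in>P. \<forall>y\<in>P. le x y \<longrightarrow> (\<forall>c1 c2. satchain P le x y c1 \<longrightarrow> satchain P le x y c2 \<longrightarrow>
         lword lam c1 = lword lam c2 \<longrightarrow> c1 = c2))"

definition Cch :: "'a set \<Rightarrow> ('a \<Rightarrow> 'a \<Rightarrow> bool) \<Rightarrow> 'a \<Rightarrow> 'a list set" where
  "Cch P le z0 = {cs. \<exists>y. satchain P le z0 y cs}"

definition qexch :: "'a set \<Rightarrow> ('a \<Rightarrow> 'a \<Rightarrow> bool) \<Rightarrow> 'a \<Rightarrow> ('a \<Rightarrow> 'a \<Rightarrow> 'l)
    \<Rightarrow> ('l \<Rightarrow> 'l \<Rightarrow> bool) \<Rightarrow> 'a list \<Rightarrow> 'a list \<Rightarrow> bool" where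
  "qexch P le z0 lam llt cs cs' \<longleftrightarrow> cs \<in> Cch P le z0 \<and> cs' \<in> Cch P le z0 \<and>
     (\<exists>i x'. 0 < i \<and> Suc i < length cs \<and> cs' = cs[i := x'] \<and>
        llt (lam (cs ! (i - 1)) (cs ! i)) (lam (cs ! i) (cs ! Suc i)) \<and>
        covers P le (cs ! (i - 1)) x' \<and> covers P le x' (cs ! Suc i) \<and>
        lam (cs ! (i - 1)) x' = lam (cs ! i) (cs ! Suc i) \<and>
        lam x' (cs ! Suc i) = lam (cs ! (i - 1)) (cs ! i))"

definition qrel :: "'a set \<Rightarrow> ('a \<Rightarrow> 'a \<Rightarrow> bool) \<Rightarrow> 'a \<Rightarrow> ('a \<Rightarrow> 'a \<Rightarrow> 'l)
    \<Rightarrow> ('l \<Rightarrow> 'l \<Rightarrow> bool) \<Rightarrow> ('a list \<times> 'a list) set" where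
  "qrel P le z0 lam llt = {(a, b). a \<in> Cch P le z0 \<and> b \<in> Cch P le z0 \<and>
      (symclp (qexch P le z0 lam llt))\<^sup>*\<^sup>* a b}"

definition Qcar :: "'a set \<Rightarrow> ('a \<Rightarrow> 'a \<Rightarrow> bool) \<Rightarrow> 'a \<Rightarrow> ('a \<Rightarrow> 'a \<Rightarrow> 'l)
    \<Rightarrow> ('l \<Rightarrow> 'l \<Rightarrow> bool) \<Rightarrow> 'a list set set" where
  "Qcar P le z0 lam llt = Cch P le z0 // qrel P le z0 lam llt"

definition Qle :: "'a set \<Rightarrow> ('a \<Rightarrow> 'a \<Rightarrow> bool) \<Rightarrow> 'a \<Rightarrow> ('a \<Rightarrow> 'a \<Rightarrow> 'l)
    \<Rightarrow> ('l \<Rightarrow> 'l \<Rightarrow> bool) \<Rightarrow> 'a list set \<Rightarrow> 'a list set \<Rightarrow> bool" where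
  "Qle P le z0 lam llt = (\<lambda>X Y. X \<in> Qcar P le z0 lam llt \<and> Y \<in> Qcar P le z0 lam llt \<and>
      (\<exists>c\<in>X. \<exists>d\<in>Y. set c \<subseteq> set d))\<^sup>+\<^sup>+"

definition Qbot :: "'a set \<Rightarrow> ('a \<Rightarrow> 'a \<Rightarrow> bool) \<Rightarrow> 'a \<Rightarrow> ('a \<Rightarrow> 'a \<Rightarrow> 'l)
    \<Rightarrow> ('l \<Rightarrow> 'l \<Rightarrow> bool) \<Rightarrow> 'a list set" where
  "Qbot P le z0 lam llt = qrel P le z0 lam llt `` {[z0]}"

definition is_mobius :: "'a set \<Rightarrow> ('a \<Rightarrow> 'a \<Rightarrow> bool) \<Rightarrow> ('a \<Rightarrow> 'a \<Rightarrow> int) \<Rightarrow> bool" where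
  "is_mobius P le m \<longleftrightarrow> (\<forall>x y. m x y =
     (if x \<in> P \<and> y \<in> P \<and> le x y then
        (if x = y then 1 else - (\<Sum>z\<in>{z\<in>P. le x z \<and> strict le z y}. m x z))
      else 0))"

definition mobius :: "'a set \<Rightarrow> ('a \<Rightarrow> 'a \<Rightarrow> bool) \<Rightarrow> 'a \<Rightarrow> 'a \<Rightarrow> int" where
  "mobius P le = (THE m. is_mobius P le m)"

definition prank :: "'a set \<Rightarrow> ('a \<Rightarrow> 'a \<Rightarrow> bool) \<Rightarrow> 'a \<Rightarrow> 'a \<Rightarrow> nat" where
  "prank P le z0 x = (THE k. \<exists>cs. satchain P le z0 x cs \<and> length cs = Suc k)"

definition graded_with_bot :: "'a set \<Rightarrow> ('a \<Rightarrow> 'a \<Rightarrow> bool) \<Rightarrow> 'a \<Rightarrow> bool" where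
  "graded_with_bot P le z0 \<longleftrightarrow> finite P \<and> partial_order_on P le \<and> z0 \<in> P \<and>
     (\<forall>x\<in>P. le z0 x) \<and>
     (\<forall>x\<in>P. \<forall>c1 c2. satchain P le z0 x c1 \<longrightarrow> satchain P le z0 x c2 \<longrightarrow>
        length c1 = length c2)"

definition whitney_w :: "'a set \<Rightarrow> ('a \<Rightarrow> 'a \<Rightarrow> bool) \<Rightarrow> 'a \<Rightarrow> nat \<Rightarrow> int" where
  "whitney_w P le z0 k = (\<Sum>x\<in>{x\<in>P. prank P le z0 x = k}. mobius P le z0 x)"

definition whitney_W :: "'a set \<Rightarrow> ('a \<Rightarrow> 'a \<Rightarrow> bool) \<Rightarrow> 'a \<Rightarrow> nat \<Rightarrow> nat" where
  "whitney_W P le z0 k = card {x\<in>P. prank P le z0 x = k}"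

definition whitney_duals :: "'a set \<Rightarrow> ('a \<Rightarrow> 'a \<Rightarrow> bool) \<Rightarrow> 'a \<Rightarrow>
    'b set \<Rightarrow> ('b \<Rightarrow> 'b \<Rightarrow> bool) \<Rightarrow> 'b \<Rightarrow> bool" where
  "whitney_duals P leP z0P Q leQ z0Q \<longleftrightarrow>
     graded_with_bot P leP z0P \<and> graded_with_bot Q leQ z0Q \<and>
     (\<forall>k. \<bar>whitney_w P leP z0P k\<bar> = int (whitney_W Q leQ z0Q k) \<and>
          \<bar>whitney_w Q leQ z0Q k\<bar> = int (whitney_W P leP z0P k))"

text \<open>A weighted partition of [n] is a set of (block, weight) pairs.\<close>
type_synonym wpart = "(nat set \<times> nat) set"

definition WP :: "nat \<Rightarrow> wpart set" where
  "WP n = {x. (\<forall>(B, v)\<in>x. B \<noteq> {} \<and> v < card B) \<and>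
              \<Union>(fst ` x) = {1..n} \<and>
              (\<forall>p\<in>x. \<forall>q\<in>x. p \<noteq> q \<longrightarrow> fst p \<inter> fst q = {})}"

definition wcov :: "nat \<Rightarrow> wpart \<Rightarrow> wpart \<Rightarrow> bool" where
  "wcov n x y \<longleftrightarrow> x \<in> WP n \<and> y \<in> WP n \<and>
     (\<exists>A wA B wB u. (A, wA) \<in> x \<and> (B, wB) \<in> x \<and> A \<noteq> B \<and> u \<le> 1 \<and>
        y = (x - {(A, wA), (B, wB)}) \<union> {(A \<union> B, wA + wB + u)})"

definition wle :: "nat \<Rightarrow> wpart \<Rightarrow> wpart \<Rightarrow> bool" where
  "wle n x y \<longleftrightarrow> x \<in> WP n \<and> y \<in> WP n \<and> (wcov n)\<^sup>*\<^sup>* x y"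

definition wbot :: "nat \<Rightarrow> wpart" where
  "wbot n = (\<lambda>i. ({i}, 0)) ` {1..n}"

text \<open>The labeling lambda_E: label (min A, min B)^u encoded as (min A, min B, u).\<close>
definition lamE :: "wpart \<Rightarrow> wpart \<Rightarrow> nat \<times> nat \<times> nat" where
  "lamE x y = (THE l. \<exists>A wA B wB u. (A, wA) \<in> x \<and> (B, wB) \<in> x \<and> Min A < Min B \<and> u \<le> 1 \<and>
       y = (x - {(A, wA), (B, wB)}) \<union> {(A \<union> B, wA + wB + u)} \<and> l = (Min A, Min B, u))"

text \<open>The label poset Lambda_n = Gamma_1 (+) ... (+) Gamma_n (ordinal sum).\<close>
definition Lambda :: "nat \<Rightarrow> (nat \<times> nat \<times> nat) set" where
  "Lambda n = {(a, b, u). 1 \<le> a \<and> a < b \<and> b \<le> n + 1 \<and> u \<le> 1}"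

definition lab_le :: "nat \<Rightarrow> nat \<times> nat \<times> nat \<Rightarrow> nat \<times> nat \<times> nat \<Rightarrow> bool" where
  "lab_le n l1 l2 \<longleftrightarrow> l1 \<in> Lambda n \<and> l2 \<in> Lambda n \<and>
     (case (l1, l2) of ((a, b, u), (c, d, v)) \<Rightarrow> a < c \<or> (a = c \<and> b \<le> d \<and> u \<le> v))"

definition lab_lt :: "nat \<Rightarrow> nat \<times> nat \<times> nat \<Rightarrow> nat \<times> nat \<times> nat \<Rightarrow> bool" where
  "lab_lt n l1 l2 \<longleftrightarrow> lab_le n l1 l2 \<and> l1 \<noteq> l2"

end

(*
An EW-labeling always yields a Whitney dual. By rank two switching and injectivity of label words,
a quadratic exchange class is determined by its words up to commuting comparable neighbouring
letters, and in such a trace class the ascent-free word is unique; so the rank k elements of Q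
correspond to the ascent-free chains of length k. Moving the letter at the boundary of an
ascent-free lower and an increasing upper part of a word across that boundary is a sign-reversing
involution. Applied to the chains of [0,y] it gives mu_P(0,y) = (-1)^k #(ascent-free chains); with
the two roles exchanged and applied to the chains in a class X it gives mu_Q(0,X) = (-1)^k if X
contains the increasing chain of its interval and 0 otherwise.

For weighted partitions, x <= y iff every block B^v of y is a union of t blocks of x with total
weight S where S <= v <= S + t - 1. Along an increasing chain from x to y the blocks of y are built
up in the order of their minima, each by adding its parts in the order of their minima, with all
the increments 0 before the increments 1; so every label is determined by what remains to be done.
*)

theory Submission
  imports Defs
begin

text \<open>The labels are only partially ordered, so an ascent-free word need not decrease, and
  incomparable neighbours cannot be exchanged. Words of one class are therefore compared through
  projections to pairs of non-commuting letters: exchanges in either direction preserve these, and a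
  common prefix cancels from them. The involution itself is never built. A Moebius function is
  determined by the vanishing of its interval sums, and for a single word the signed count of
  admissible cuts is already 0. What remains on each side is a bijection between chains with a cut
  and the objects being summed. For P the increasing chain above the cut is recovered from its ends;
  for Q the ascent-free suffix is recovered from the class and the prefix. For weighted partitions
  the order is generated by merges, and the chain-free test for x <= y tells which merges stay below
  y. The decisive fact is local: if the next label is the forced first label of what remains, an
  ascent occurs exactly when the present label is forced too. This one equivalence gives both
  existence and uniqueness of the increasing chain.\<close>

section \<open>Words over a partially ordered alphabet\<close>

text \<open>The step across the cut is unconstrained. If the word begins with an
  \<open>R\<close>-step, only the cuts 0 and 1 can be admissible, and they are so together;
  otherwise cut 0 is excluded and the remaining cuts are those of the tail with opposite sign. No
  property of \<open>R\<close> is assumed, so the lemma also applies to the complementary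
  relation.\<close>

lemma alternating_sum_split_eq_0:
  assumes "w \<noteq> []"
  shows "(\<Sum>i | i \<le> length w \<and> successively (\<lambda>a b. \<not> R a b) (take i w) \<and>
            successively R (drop i w). (-1) ^ i) = (0::int)"
  using assms
proof (induction w rule: induct_list012)
  case (2 a)
  have "{i. i \<le> length [a] \<and> successively (\<lambda>a b. \<not> R a b) (take i [a]) \<and>
            successively R (drop i [a])} = {0, 1}"
    by (auto simp: le_Suc_eq)
  then show ?case by simp
next
  case (3 a b w)
  let ?I = "\<lambda>w. {i. i \<le> length w \<and> successively (\<lambda>a b. \<not> R a b) (take i w) \<and>
            successively R (drop i w)}"
  show ?case
  proof (cases "R a b")
    case True
    have "i \<in> ?I (a # b # w) \<longleftrightarrow> i \<in> (if successively R (b # w) then {0, 1} else {})" for i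
    proof (cases i)
      case (Suc j)
      then show ?thesis using True by (cases j) auto
    qed (use True in auto)
    then have "?I (a # b # w) = (if successively R (b # w) then {0, 1} else {})"
      by blast
    then show ?thesis by auto
  next
    case False
    have "i \<in> ?I (a # b # w) \<longleftrightarrow> i \<in> Suc ` ?I (b # w)" for i
    proof (cases i)
      case (Suc j)
      then show ?thesis using False by (cases j) (auto simp: image_iff)
    qed (use False in auto)
    then have "?I (a # b # w) = Suc ` ?I (b # w)"
      by blast
    then have "(\<Sum>i\<in>?I (a # b # w). (-1) ^ i) = - (\<Sum>i\<in>?I (b # w). (-1::int) ^ i)"
      by (simp add: sum.reindex sum_negf)
    then show ?thesis using 3 by simp
  qed
qed simp

section \<open>Partially commutative words and their ascent-free representatives\<close>

locale strict_order =
  fixes llt :: "'l \<Rightarrow> 'l \<Rightarrow> bool"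
  assumes llt_irrefl: "\<not> llt a a"
    and llt_trans: "llt a b \<Longrightarrow> llt b c \<Longrightarrow> llt a c"
begin

lemma llt_asym: "llt a b \<Longrightarrow> \<not> llt b a"
  using llt_irrefl llt_trans by blast

abbreviation ascent_free :: "'l list \<Rightarrow> bool" where
  "ascent_free w \<equiv> successively (\<lambda>a b. \<not> llt a b) w"

abbreviation increasing :: "'l list \<Rightarrow> bool" where
  "increasing w \<equiv> successively llt w"

text \<open>Equality in the partially commutative monoid in which two letters commute iff they are
  comparable, expressed through the projections to pairs of non-commuting letters.\<close>

definition trace_eq :: "'l list \<Rightarrow> 'l list \<Rightarrow> bool" where
  "trace_eq w w' \<longleftrightarrow> (\<forall>a b. \<not> llt a b \<longrightarrow> \<not> llt b a \<longrightarrow>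
     filter (\<lambda>x. x = a \<or> x = b) w = filter (\<lambda>x. x = a \<or> x = b) w')"

lemma trace_eq_refl: "trace_eq w w"
  and trace_eq_sym: "trace_eq w w' \<Longrightarrow> trace_eq w' w"
  and trace_eq_trans: "trace_eq w w' \<Longrightarrow> trace_eq w' w'' \<Longrightarrow> trace_eq w w''"
  unfolding trace_eq_def by auto

text \<open>A projection to a non-commuting pair keeps at most one of two comparable letters, so it
  cannot see their order.\<close>

lemma trace_eq_swap: "llt a b \<Longrightarrow> trace_eq (u @ a # b # v) (u @ b # a # v)"
  using llt_irrefl unfolding trace_eq_def by auto

text \<open>Filtering commutes with concatenation, so each projection of the two sides begins with
  the same word, which cancels.\<close>

lemma trace_eq_append_cancel:
  "trace_eq u u' \<Longrightarrow> trace_eq (u @ v) (u' @ v') \<Longrightarrow> trace_eq v v'"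
  unfolding trace_eq_def by simp

text \<open>Going from right to left, the letter after \<open>c\<close> is \<open>z\<close> or lies
  above \<open>z\<close>. If \<open>c\<close> were below \<open>z\<close>, transitivity would create
  an ascent at \<open>c\<close>; comparability then leaves only \<open>z\<close> below
  \<open>c\<close>.\<close>

lemma ascent_free_snoc_comparable:
  assumes "ascent_free (u @ [z])" "\<forall>c\<in>set u. llt c z \<or> llt z c"
  shows "\<forall>c\<in>set u. llt z c"
  using assms
proof (induction u)
  case (Cons c u)
  then have IH: "\<forall>c\<in>set u. llt z c"
    by (cases "u @ [z]") auto
  have "\<not> llt c z"
    using Cons.prems(1) IH llt_trans by (cases u) auto
  then show ?case using IH Cons.prems(2) by auto
qed simp

text \<open>Since \<open>a'\<close> can be moved to the front, every letter before its first
  occurrence in \<open>a # w\<close> commutes with it. In an ascent-free word such letters,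
  \<open>a\<close> among them, all lie above \<open>a'\<close>.\<close>

lemma trace_eq_first_letter:
  assumes tr: "trace_eq (a # w) (a' # w')" and af: "ascent_free (a # w)" and "a \<noteq> a'"
  shows "llt a' a"
proof -
  \<comment> \<open>By irreflexivity the pair of \<open>a'\<close> with itself counts as
    non-commuting, so trace-equal words contain each letter equally often.\<close>
  have "filter (\<lambda>x. x = a' \<or> x = a') (a # w) = filter (\<lambda>x. x = a' \<or> x = a') (a' # w')"
    using tr llt_irrefl unfolding trace_eq_def by blast
  then have "a' \<in> set (filter (\<lambda>x. x = a' \<or> x = a') (a # w))"
    by simp
  then have "a' \<in> set (a # w)"
    by (auto split: if_splits)
  then obtain u v where uv: "a # w = u @ a' # v" "a' \<notin> set u"
    by (meson split_list_first)
  have "llt c a' \<or> llt a' c" if c: "c \<in> set u" for c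
  proof (rule ccontr)
    let ?f = "filter (\<lambda>x. x = c \<or> x = a')"
    assume "\<not> (llt c a' \<or> llt a' c)"
    then have "?f (u @ a' # v) = ?f (a' # w')"
      using tr uv(1) unfolding trace_eq_def by metis
    moreover have "?f u \<noteq> []"
      using c by (auto simp: filter_empty_conv)
    ultimately have "hd (?f u) = a'"
      by (cases "?f u") auto
    then show False
      using \<open>?f u \<noteq> []\<close> uv(2) using hd_in_set[of "?f u"] by auto
  qed
  moreover have "ascent_free (u @ [a'])"
    using af uv(1) by (auto simp: successively_append_iff)
  ultimately have "\<forall>c\<in>set u. llt a' c"
    using ascent_free_snoc_comparable by blast
  moreover have "a \<in> set u"
    using uv(1) \<open>a \<noteq> a'\<close> by (cases u) auto
  ultimately show ?thesis by blast
qed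

text \<open>Different first letters would each lie below the other, against asymmetry; an equal
  first letter cancels.\<close>

lemma trace_eq_ascent_free_unique:
  assumes "trace_eq w w'" "ascent_free w" "ascent_free w'"
  shows "w = w'"
  using assms
proof (induction w arbitrary: w')
  case Nil
  show ?case
  proof (cases w')
    case (Cons a v)
    have "filter (\<lambda>x. x = a \<or> x = a) [] = filter (\<lambda>x. x = a \<or> x = a) w'"
      using Nil.prems(1) llt_irrefl unfolding trace_eq_def by blast
    then show ?thesis using Cons by simp
  qed simp
next
  case (Cons a w)
  show ?case
  proof (cases w')
    case Nil
    have "filter (\<lambda>x. x = a \<or> x = a) (a # w) = filter (\<lambda>x. x = a \<or> x = a) w'"
      using Cons.prems(1) llt_irrefl unfolding trace_eq_def by blast
    then show ?thesis using Nil by simp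
  next
    case w': (Cons a' v)
    have "a = a'"
      using trace_eq_first_letter[of a w a' v] trace_eq_first_letter[of a' v a w]
        trace_eq_sym llt_asym Cons.prems w' by metis
    moreover have "w = v"
    proof (rule Cons.IH)
      show "trace_eq w v"
        using Cons.prems(1) trace_eq_append_cancel[of "[a]" "[a]" w v] trace_eq_refl w' \<open>a = a'\<close>
        by simp
      show "ascent_free w" using Cons.prems(2) by (cases w) auto
      show "ascent_free v" using Cons.prems(3) w' by (cases v) auto
    qed
    ultimately show ?thesis using w' by simp
  qed
qed

fun num_ascending_pairs :: "'l list \<Rightarrow> nat" where
  "num_ascending_pairs [] = 0"
| "num_ascending_pairs (a # w) = length (filter (llt a) w) + num_ascending_pairs w"

text \<open>Only the two exchanged letters change their relative order, and they stop being an
  ascending pair. This is why forward exchanges terminate.\<close>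

lemma num_ascending_pairs_swap:
  "llt a b \<Longrightarrow> num_ascending_pairs (u @ b # a # v) < num_ascending_pairs (u @ a # b # v)"
  by (induction u) (auto simp: llt_asym)

end

section \<open>Saturated chains\<close>

lemma satchain_single: "x \<in> P \<Longrightarrow> satchain P le x x [x]"
  unfolding satchain_def by simp

lemma satchain_append:
  "satchain P le x z c \<Longrightarrow> satchain P le z y d \<Longrightarrow> satchain P le x y (c @ tl d)"
  unfolding satchain_def
  by (cases d; cases "tl d") (auto simp: successively_append_iff)

lemma satchain_Cons: "covers P le x y \<Longrightarrow> satchain P le y z cs \<Longrightarrow> satchain P le x z (x # cs)"
  unfolding satchain_def by (cases cs) (auto simp: covers_def)

lemma satchain_ConsE:
  assumes "satchain P le x y (c # cs)"
  obtains "c = x" "x = y" "cs = []"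
  | z where "c = x" "covers P le x z" "satchain P le z y cs"
  using assms unfolding satchain_def by (cases cs) (auto split: if_splits)

lemma satchain_take:
  assumes "satchain P le x y cs" "i < length cs"
  shows "satchain P le x (cs ! i) (take (Suc i) cs)"
proof -
  have "successively (covers P le) (take (Suc i) cs @ drop (Suc i) cs)"
    using assms unfolding satchain_def by simp
  then have "successively (covers P le) (take (Suc i) cs)"
    unfolding successively_append_iff by blast
  moreover have "last (take (Suc i) cs) = cs ! i"
    using assms(2) by (simp add: take_Suc_conv_app_nth)
  ultimately show ?thesis
    using assms set_take_subset[of "Suc i" cs] unfolding satchain_def by auto
qed

lemma satchain_drop:
  assumes "satchain P le x y cs" "i < length cs"
  shows "satchain P le (cs ! i) y (drop i cs)"
proof -
  have "successively (covers P le) (take i cs @ drop i cs)"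
    using assms unfolding satchain_def by simp
  then have "successively (covers P le) (drop i cs)"
    unfolding successively_append_iff by blast
  then show ?thesis
    using assms set_drop_subset[of i cs] unfolding satchain_def
    by (auto simp: hd_drop_conv_nth)
qed

lemma satchain_nth_covers:
  "satchain P le x y cs \<Longrightarrow> Suc i < length cs \<Longrightarrow> covers P le (cs ! i) (cs ! Suc i)"
  unfolding satchain_def successively_conv_nth by blast

lemma length_lword: "length (lword lam cs) = length cs - 1"
  unfolding lword_def by simp

lemma lword_simps [simp]:
  "lword lam [] = []"
  "lword lam [x] = []"
  "lword lam (x # y # cs) = lam x y # lword lam (y # cs)"
  unfolding lword_def by simp_all

lemma lword_take: "lword lam (take (Suc i) cs) = take i (lword lam cs)"
proof (induction cs arbitrary: i rule: induct_list012)
  case (3 x y cs)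
  then show ?case by (cases i) auto
qed auto

lemma lword_drop: "lword lam (drop i cs) = drop i (lword lam cs)"
  unfolding lword_def by (simp add: drop_map drop_zip tl_drop)

section \<open>Ranked posets and Moebius functions\<close>

text \<open>\<open>mobius\<close> is a definite description, so a solution of its recurrence has to
  be exhibited first. The conditions on \<open>P\<close> and \<open>le\<close> sit inside the body
  so that the recursion terminates on all arguments: the down-set of \<open>z\<close> is strictly
  smaller than that of \<open>y\<close>.\<close>

function mobius_rec :: "'a set \<Rightarrow> ('a \<Rightarrow> 'a \<Rightarrow> bool) \<Rightarrow> 'a \<Rightarrow> 'a \<Rightarrow> int" where
  "mobius_rec P le x y =
     (if finite P \<and> partial_order_on P le \<and> x \<in> P \<and> y \<in> P \<and> le x y then
        (if x = y then 1 else - (\<Sum>z\<in>{z\<in>P. le x z \<and> strict le z y}. mobius_rec P le x z))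
      else 0)"
  by auto
termination
proof (relation "measure (\<lambda>(P, le, x, y). card {z \<in> P. le z y})", goal_cases)
  case (2 P le x y z)
  have "{w \<in> P. le w z} \<subset> {w \<in> P. le w y}"
  proof
    show "{w \<in> P. le w z} \<subseteq> {w \<in> P. le w y}"
      using 2 unfolding partial_order_on_def strict_def by blast
    show "{w \<in> P. le w z} \<noteq> {w \<in> P. le w y}"
      using 2 unfolding partial_order_on_def strict_def by blast
  qed
  then show ?case using 2 by (simp add: psubset_card_mono)
qed simp

declare mobius_rec.simps [simp del]

lemma is_mobiusD:
  "is_mobius P le m \<Longrightarrow> m x y = (if x \<in> P \<and> y \<in> P \<and> le x y then
     if x = y then 1 else - (\<Sum>z\<in>{z\<in>P. le x z \<and> strict le z y}. m x z) else 0)"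
  unfolding is_mobius_def by blast

text \<open>The recurrence determines each value from those strictly below, so it is enough to guess
  the row at \<open>x\<close> and to check that its sums over intervals vanish.\<close>

lemma mobius_eqI:
  assumes fin: "finite P" and po: "partial_order_on P le"
    and f: "f x = 1" "\<And>y. y \<in> P \<Longrightarrow> le x y \<Longrightarrow> y \<noteq> x \<Longrightarrow> (\<Sum>z | z \<in> P \<and> le x z \<and> le z y. f z) = 0"
    and xy: "x \<in> P" "y \<in> P" "le x y"
  shows "mobius P le x y = f y"
proof -
  have rec: "is_mobius P le (mobius_rec P le)"
    unfolding is_mobius_def using fin po by (intro allI, subst mobius_rec.simps) simp
  \<comment> \<open>This is used twice: with a row of \<open>mobius_rec\<close> as \<open>f\<close>,
    which makes the definite description well defined, and then with the given
    \<open>f\<close>.\<close>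
  have uniq: "m x y = f y"
    if m: "is_mobius P le m" and f1: "f x = 1"
      and f0: "\<And>y. y \<in> P \<Longrightarrow> le x y \<Longrightarrow> y \<noteq> x \<Longrightarrow> (\<Sum>z | z \<in> P \<and> le x z \<and> le z y. f z) = (0::int)"
      and "x \<in> P" "y \<in> P" "le x y" for m f x y
    using that(4-6)
  proof (induction "card {z \<in> P. le z y}" arbitrary: y rule: less_induct)
    case less
    show ?case
    proof (cases "x = y")
      case False
      let ?I = "{z \<in> P. le x z \<and> strict le z y}"
      have "m x z = f z" if "z \<in> ?I" for z
      proof (rule less.hyps)
        have "{w \<in> P. le w z} \<subseteq> {w \<in> P. le w y}"
          using that less.prems po unfolding partial_order_on_def strict_def by blast
        moreover have "{w \<in> P. le w z} \<noteq> {w \<in> P. le w y}"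
          using that less.prems po unfolding partial_order_on_def strict_def by blast
        ultimately show "card {w \<in> P. le w z} < card {w \<in> P. le w y}"
          using fin by (simp add: psubset_card_mono psubset_eq)
      qed (use that \<open>x \<in> P\<close> in auto)
      then have "m x y = - (\<Sum>z\<in>?I. f z)"
        using is_mobiusD[OF m, of x y] less.prems False by simp
      moreover have "{z. z \<in> P \<and> le x z \<and> le z y} = insert y ?I"
        using less.prems po unfolding partial_order_on_def strict_def by blast
      then have "(\<Sum>z | z \<in> P \<and> le x z \<and> le z y. f z) = f y + (\<Sum>z\<in>?I. f z)"
        using fin by (simp add: strict_def)
      ultimately show ?thesis
        using f0[of y] less.prems False by simp
    qed (use is_mobiusD[OF m, of x y] f1 less.prems in simp)
  qed
  have "mobius P le = mobius_rec P le"
    unfolding mobius_def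
  proof (rule the_equality, rule rec, intro ext)
    fix m x y assume m: "is_mobius P le m"
    show "m x y = mobius_rec P le x y"
    proof (cases "x \<in> P \<and> y \<in> P \<and> le x y")
      case True
      have "(\<Sum>z | z \<in> P \<and> le x z \<and> le z y. mobius_rec P le x z) = 0"
        if y: "y \<in> P" "le x y" "y \<noteq> x" for y
      proof -
        have "{z. z \<in> P \<and> le x z \<and> le z y} = insert y {z \<in> P. le x z \<and> strict le z y}"
          using y po unfolding partial_order_on_def strict_def by blast
        then show ?thesis
          using fin is_mobiusD[OF rec, of x y] y True by (simp add: strict_def)
      qed
      moreover have "mobius_rec P le x x = 1"
        using is_mobiusD[OF rec, of x x] True po unfolding partial_order_on_def by simp
      ultimately show ?thesis
        using uniq[OF m, of "mobius_rec P le x" x y] True by blast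
    qed (use is_mobiusD[OF m, of x y] is_mobiusD[OF rec, of x y] in auto)
  qed
  then show ?thesis
    using uniq[OF rec, of f x y] f xy by simp
qed

text \<open>The rank function is a parameter that only has to grow by one along covers; equal chain
  lengths and the value of \<open>prank\<close> follow from it. The poset and its quotient are both
  handled as instances.\<close>

locale ranked_poset =
  fixes P :: "'a set" and le :: "'a \<Rightarrow> 'a \<Rightarrow> bool" and z0 :: 'a and rk :: "'a \<Rightarrow> nat"
  assumes finite_carrier: "finite P"
    and po: "partial_order_on P le"
    and bot_in: "z0 \<in> P"
    and bot_le: "x \<in> P \<Longrightarrow> le z0 x"
    and rk_bot: "rk z0 = 0"
    and rk_covers: "covers P le x y \<Longrightarrow> rk y = Suc (rk x)"
begin

lemma le_refl: "x \<in> P \<Longrightarrow> le x x"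
  and le_antisym: "x \<in> P \<Longrightarrow> y \<in> P \<Longrightarrow> le x y \<Longrightarrow> le y x \<Longrightarrow> x = y"
  and le_trans: "x \<in> P \<Longrightarrow> y \<in> P \<Longrightarrow> z \<in> P \<Longrightarrow> le x y \<Longrightarrow> le y z \<Longrightarrow> le x z"
  using po unfolding partial_order_on_def by blast+

lemma satchain_exists:
  assumes "x \<in> P" "y \<in> P" "le x y"
  shows "\<exists>cs. satchain P le x y cs"
  using assms
proof (induction "card {w \<in> P. le x w \<and> le w y}" arbitrary: x y rule: less_induct)
  case less
  consider "x = y" | "covers P le x y" | z where "z \<in> P" "strict le x z" "strict le z y"
    using less.prems unfolding covers_def strict_def by blast
  then show ?case
  proof cases
    case 1
    then show ?thesis using satchain_single[OF less.prems(2)] by auto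
  next
    case 2
    then show ?thesis
      using satchain_Cons[OF _ satchain_single[OF less.prems(2)]] by blast
  next
    case 3
    let ?S = "{w \<in> P. le x w \<and> le w y}"
    have z: "le x z" "le z y" "z \<noteq> x" "z \<noteq> y" using 3 unfolding strict_def by auto
    have "{w \<in> P. le x w \<and> le w z} \<subseteq> ?S"
      using le_trans[OF _ 3(1) less.prems(2)] z by blast
    moreover have "y \<in> ?S" "y \<notin> {w \<in> P. le x w \<and> le w z}"
      using less.prems le_refl le_antisym[OF 3(1), of y] z by auto
    ultimately have "card {w \<in> P. le x w \<and> le w z} < card ?S"
      using finite_carrier by (intro psubset_card_mono) auto
    moreover have "{w \<in> P. le z w \<and> le w y} \<subseteq> ?S"
      using le_trans[OF less.prems(1) 3(1)] z by blast
    moreover have "x \<in> ?S" "x \<notin> {w \<in> P. le z w \<and> le w y}"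
      using less.prems le_refl le_antisym[OF 3(1), of x] z by auto
    ultimately have "card {w \<in> P. le x w \<and> le w z} < card ?S"
      "card {w \<in> P. le z w \<and> le w y} < card ?S"
      using psubset_card_mono[of ?S "{w \<in> P. le z w \<and> le w y}"] finite_carrier by auto
    then obtain c d where "satchain P le x z c" "satchain P le z y d"
      using less.hyps[of x z] less.hyps[of z y] less.prems 3(1) z by blast
    then show ?thesis
      by (intro exI[of _ "c @ tl d"]) (rule satchain_append)
  qed
qed

lemma satchain_in:
  assumes "satchain P le x y cs"
  shows "x \<in> P" "y \<in> P"
  using assms hd_in_set[of cs] last_in_set[of cs] unfolding satchain_def by blast+

lemma satchain_le:
  assumes "satchain P le x y cs"
  shows "le x y"
  using assms
proof (induction cs arbitrary: x)
  case (Cons c cs)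
  from Cons.prems show ?case
  proof (rule satchain_ConsE)
    assume "x = y"
    then show ?case using le_refl satchain_in[OF Cons.prems] by simp
  next
    fix z assume "covers P le x z" "satchain P le z y cs"
    then show ?case
      using Cons.IH[of z] le_trans[of x z y] satchain_in[of z y cs]
      unfolding covers_def strict_def by blast
  qed
qed (simp add: satchain_def)

lemma rk_satchain_last:
  assumes "satchain P le x y cs"
  shows "rk y + 1 = rk x + length cs"
  using assms
proof (induction cs arbitrary: x)
  case (Cons c cs)
  from Cons.prems show ?case
  proof (rule satchain_ConsE)
    fix z assume "covers P le x z" "satchain P le z y cs"
    then show ?case
      using Cons.IH[of z] rk_covers[of x z] by simp
  qed simp
qed (simp add: satchain_def)

lemma rk_satchain_nth:
  assumes "satchain P le z0 y cs" "i < length cs"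
  shows "rk (cs ! i) = i"
  using rk_satchain_last[OF satchain_take[OF assms]] rk_bot assms(2) by simp

lemma satchain_rk: "satchain P le z0 y cs \<Longrightarrow> length cs = Suc (rk y)"
  using rk_satchain_last[of z0 y cs] rk_bot by simp

lemma graded_with_bot: "graded_with_bot P le z0"
  unfolding graded_with_bot_def
  using finite_carrier po bot_in bot_le satchain_rk by metis

lemma prank_eq:
  assumes "y \<in> P"
  shows "prank P le z0 y = rk y"
  unfolding prank_def
proof (rule the_equality)
  show "\<exists>cs. satchain P le z0 y cs \<and> length cs = Suc (rk y)"
    using satchain_exists[OF bot_in assms bot_le] assms satchain_rk by blast
qed (use satchain_rk in force)

lemma whitney_W_eq: "whitney_W P le z0 k = card {x \<in> P. rk x = k}"
  unfolding whitney_W_def by (rule arg_cong[where f = card]) (auto simp: prank_eq)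

lemma whitney_w_eq:
  assumes "f z0 = 1" "\<And>y. y \<in> P \<Longrightarrow> y \<noteq> z0 \<Longrightarrow> (\<Sum>z | z \<in> P \<and> le z y. f z) = 0"
  shows "whitney_w P le z0 k = (\<Sum>x | x \<in> P \<and> rk x = k. f x)"
  unfolding whitney_w_def
proof (rule sum.cong)
  fix y assume "y \<in> {x \<in> P. rk x = k}"
  moreover have "{z. z \<in> P \<and> le z0 z \<and> le z y} = {z. z \<in> P \<and> le z y}" for y
    using bot_le by blast
  ultimately show "mobius P le z0 y = f y"
    using mobius_eqI[OF finite_carrier po, of f z0 y] assms bot_in bot_le by simp
qed (auto simp: prank_eq)

lemma finite_satchains: "finite {cs. satchain P le z0 y cs}"
proof (rule finite_subset)
  show "{cs. satchain P le z0 y cs} \<subseteq> {cs. set cs \<subseteq> P \<and> length cs = Suc (rk y)}"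
    using satchain_rk unfolding satchain_def by blast
  show "finite {cs. set cs \<subseteq> P \<and> length cs = Suc (rk y)}"
    using finite_carrier finite_lists_length_eq by blast
qed

text \<open>In a chain from the bottom the position of an element is its rank, so a common element
  has the same position in both chains. This turns the inclusion in the order of \<open>Qle\<close>
  into extension of lists.\<close>

lemma satchain_prefix:
  assumes c: "satchain P le z0 x c" and d: "satchain P le z0 y d" and "set c \<subseteq> set d"
  obtains t where "d = c @ t"
proof
  have nth: "i < length d \<and> c ! i = d ! i" if i: "i < length c" for i
  proof -
    obtain j where "j < length d" "c ! i = d ! j"
      using assms(3) i by (metis in_set_conv_nth nth_mem subsetD)
    then show ?thesis
      using rk_satchain_nth[OF c i] rk_satchain_nth[OF d, of j] by metis
  qed
  have "length c \<le> length d"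
    using nth not_le by blast
  then have "take (length c) d = c"
    using nth by (intro nth_equalityI) auto
  then show "d = c @ drop (length c) d"
    by (metis append_take_drop_id)
qed

end

section \<open>Whitney duality for EW-labelings\<close>

lemma lword_append: "lword lam (u @ a # v) = lword lam (u @ [a]) @ lword lam (a # v)"
  by (induction u rule: induct_list012) auto

lemma lword_append_Cons:
  "lword lam (u @ a # b # v) = lword lam (u @ [a]) @ lam a b # lword lam (b # v)"
  using lword_append[of lam u a "b # v"] by simp

text \<open>Cutting the glued chain at the joint returns both pieces; it supplies the preimages in
  the bijection between chains with a cut and pairs of chains.\<close>

lemma satchain_glue:
  assumes "satchain P le x z c" "satchain P le z y e"
  defines "i \<equiv> length c - 1"
  shows "i < length (c @ tl e)" "take (Suc i) (c @ tl e) = c" "drop i (c @ tl e) = e"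
    "(c @ tl e) ! i = z" "lword lam (c @ tl e) = lword lam c @ lword lam e"
proof -
  obtain u where c: "c = u @ [z]"
    using assms(1) unfolding satchain_def by (metis append_butlast_last_id)
  obtain v where e: "e = z # v"
    using assms(2) unfolding satchain_def by (metis list.collapse)
  show "i < length (c @ tl e)" "take (Suc i) (c @ tl e) = c" "drop i (c @ tl e) = e"
    "(c @ tl e) ! i = z" "lword lam (c @ tl e) = lword lam c @ lword lam e"
    using lword_append[of lam u z v] by (simp_all add: i_def c e)
qed

lemma not_ascent_free_split:
  assumes "\<not> successively (\<lambda>a b. \<not> R a b) (lword lam cs)"
  obtains u a b e v where "cs = u @ a # b # e # v" "R (lam a b) (lam b e)"
proof -
  have "\<exists>u a b e v. cs = u @ a # b # e # v \<and> R (lam a b) (lam b e)"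
    using assms
  proof (induction cs)
    case (Cons a cs)
    show ?case
    proof (cases "successively (\<lambda>a b. \<not> R a b) (lword lam cs)")
      case False
      then obtain u a' b e v where "cs = u @ a' # b # e # v" "R (lam a' b) (lam b e)"
        using Cons.IH by blast
      then have "a # cs = (a # u) @ a' # b # e # v \<and> R (lam a' b) (lam b e)"
        by simp
      then show ?thesis by blast
    next
      case True
      then have "\<exists>b e v. cs = b # e # v \<and> R (lam a b) (lam b e)"
        using Cons.prems by (cases cs; cases "tl cs") auto
      then obtain b e v where "cs = b # e # v" "R (lam a b) (lam b e)" by blast
      then have "a # cs = [] @ a # b # e # v \<and> R (lam a b) (lam b e)"
        by simp
      then show ?thesis by blast
    qed
  qed simp
  then show ?thesis using that by blast
qed

locale EW_poset = ranked_poset P le z0 rk + strict_order llt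
  for P :: "'a set" and le z0 rk and llt :: "'l \<Rightarrow> 'l \<Rightarrow> bool" +
  fixes lam :: "'a \<Rightarrow> 'a \<Rightarrow> 'l"
  assumes ew: "EW_labeling P le z0 lam llt"
begin

abbreviation "rooted_chains \<equiv> Cch P le z0"
abbreviation "exch \<equiv> qexch P le z0 lam llt"
abbreviation "rel \<equiv> qrel P le z0 lam llt"
abbreviation "Q \<equiv> Qcar P le z0 lam llt"
abbreviation "leQ \<equiv> Qle P le z0 lam llt"
abbreviation "botQ \<equiv> Qbot P le z0 lam llt"
abbreviation "word \<equiv> lword lam"

lemma increasing_chain_exists:
  "x \<in> P \<Longrightarrow> y \<in> P \<Longrightarrow> le x y \<Longrightarrow> \<exists>c. satchain P le x y c \<and> increasing (word c)"
  using ew unfolding EW_labeling_def ER_labeling_def by blast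

lemma increasing_chain_unique:
  assumes "satchain P le x y c" "satchain P le x y d" "increasing (word c)" "increasing (word d)"
  shows "c = d"
proof -
  have "\<exists>!c. satchain P le x y c \<and> increasing (word c)"
    using ew satchain_in[OF assms(1)] satchain_le[OF assms(1)]
    unfolding EW_labeling_def ER_labeling_def by blast
  then show ?thesis using assms by blast
qed

lemma word_inj:
  assumes "satchain P le x y c" "satchain P le x y d" "word c = word d"
  shows "c = d"
  using ew satchain_in[OF assms(1)] satchain_le[OF assms(1)] assms
  unfolding EW_labeling_def by blast

lemma mem_chains_iff: "c \<in> rooted_chains \<longleftrightarrow> satchain P le z0 (last c) c"
  unfolding Cch_def satchain_def by blast

section \<open>Moebius function of the labeled poset\<close>

definition af_chains :: "'a \<Rightarrow> 'a list set" where
  "af_chains y = {c. satchain P le z0 y c \<and> ascent_free (word c)}"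

lemma finite_af_chains: "finite (af_chains y)"
  unfolding af_chains_def using finite_satchains by (rule rev_finite_subset) blast

text \<open>The pairs of a chain ending at \<open>y\<close> and a position splitting it into an ascent-free lower
  and an increasing upper part are counted in two ways.\<close>

lemma sum_af_chains_eq_0:
  assumes "y \<in> P" "y \<noteq> z0"
  shows "(\<Sum>z | z \<in> P \<and> le z y. (-1) ^ rk z * int (card (af_chains z))) = 0"
proof -
  let ?D = "{d. satchain P le z0 y d}"
  let ?I = "\<lambda>w. {i. i \<le> length w \<and> ascent_free (take i w) \<and> increasing (drop i w)}"
  let ?T = "SIGMA d:?D. ?I (word d)"
  let ?S = "SIGMA z:{z \<in> P. le z y}. af_chains z"
  let ?h = "\<lambda>(d, i). (d ! i, take (Suc i) d)"
  \<comment> \<open>The part above the cut can be forgotten: it is the one increasing chain between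
    the cut element and \<open>y\<close>.\<close>
  have bij: "bij_betw ?h ?T ?S"
    unfolding bij_betw_def
  proof
    have len: "i < length d" if "(d, i) \<in> ?T" for d i
      using that unfolding satchain_def by (cases d) (auto simp: length_lword)
    show "inj_on ?h ?T"
    proof (rule inj_onI, clarify)
      fix d i d' i'
      assume m: "satchain P le z0 y d" "satchain P le z0 y d'"
        and i: "i \<le> length (word d)" "ascent_free (take i (word d))" "increasing (drop i (word d))"
        and i': "i' \<le> length (word d')" "ascent_free (take i' (word d'))"
          "increasing (drop i' (word d'))"
        and eq: "d ! i = d' ! i'" "take (Suc i) d = take (Suc i') d'"
      have l: "i < length d" "i' < length d'"
        using len[of d i] len[of d' i'] m i i' by auto
      then have "i = i'"
        using arg_cong[OF eq(2), of length] by simp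
      have "drop i d = drop i' d'"
        using satchain_drop[OF m(1) l(1)] satchain_drop[OF m(2) l(2)] i(3) i'(3) eq(1)
        by (intro increasing_chain_unique[of "d ! i" y]) (simp_all add: lword_drop)
      moreover have "take i d = take i' d'"
        using arg_cong[OF eq(2), of "take i"] \<open>i = i'\<close> by simp
      ultimately show "d = d' \<and> i = i'"
        using \<open>i = i'\<close> by (metis append_take_drop_id)
    qed
    show "?h ` ?T = ?S"
    proof (intro equalityI subsetI)
      fix s assume "s \<in> ?h ` ?T"
      then obtain d i where d: "(d, i) \<in> ?T" "s = (d ! i, take (Suc i) d)" by auto
      then have sat: "satchain P le z0 y d" by simp
      note lower = satchain_take[OF sat len[OF d(1)]] and upper = satchain_drop[OF sat len[OF d(1)]]
      show "s \<in> ?S"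
        using d lower satchain_in(1)[OF upper] satchain_le[OF upper]
        unfolding af_chains_def by (simp add: lword_take)
    next
      fix s assume "s \<in> ?S"
      then obtain z c where s: "s = (z, c)" "z \<in> P" "le z y" "satchain P le z0 z c"
        "ascent_free (word c)"
        unfolding af_chains_def by auto
      obtain e where e: "satchain P le z y e" "increasing (word e)"
        using increasing_chain_exists[OF s(2) assms(1) s(3)] by blast
      have "(c @ tl e, length c - 1) \<in> ?T"
        using satchain_append[OF s(4) e(1)] s(5) e(2)
        by (simp add: satchain_glue(5)[OF s(4) e(1)] length_lword)
      moreover have "s = ?h (c @ tl e, length c - 1)"
        using satchain_glue[OF s(4) e(1)] s(1) by simp
      ultimately show "s \<in> ?h ` ?T" by blast
    qed
  qed
  have fin: "finite ?D" "finite {z \<in> P. le z y}"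
    using finite_satchains finite_carrier by simp_all
  have finI: "finite (?I w)" for w :: "'l list"
    by (rule finite_subset[of _ "{..length w}"]) auto
  have "(\<Sum>z | z \<in> P \<and> le z y. (-1) ^ rk z * int (card (af_chains z))) =
      (\<Sum>z | z \<in> P \<and> le z y. \<Sum>c\<in>af_chains z. (-1) ^ rk z)"
    by (simp add: mult.commute)
  also have "\<dots> = (\<Sum>(z, c)\<in>?S. (-1) ^ rk z)"
    using fin finite_af_chains by (subst sum.Sigma) auto
  also have "\<dots> = (\<Sum>t\<in>?T. case ?h t of (z, c) \<Rightarrow> (-1) ^ rk z)"
    by (rule sum.reindex_bij_betw[OF bij, symmetric])
  also have "\<dots> = (\<Sum>(d, i)\<in>?T. (-1) ^ i)"
  proof (rule sum.cong)
    fix t assume "t \<in> ?T"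
    then obtain d i where t: "t = (d, i)" and d: "satchain P le z0 y d" "i \<le> length (word d)"
      by blast
    then have "i < length d"
      unfolding satchain_def by (cases d) (auto simp: length_lword)
    then show "(case ?h t of (z, c) \<Rightarrow> (-1) ^ rk z) = (case t of (d, i) \<Rightarrow> (-1::int) ^ i)"
      using rk_satchain_nth[OF d(1)] t by simp
  qed simp
  also have "\<dots> = (\<Sum>d\<in>?D. \<Sum>i\<in>?I (word d). (-1) ^ i)"
    using fin finI by (subst sum.Sigma) auto
  also have "\<dots> = 0"
  proof (rule sum.neutral, clarify)
    fix d assume d: "satchain P le z0 y d"
    then have "length d \<noteq> 1"
      using assms(2) unfolding satchain_def by (auto simp: length_Suc_conv)
    then have "word d \<noteq> []"
      using d length_lword[of lam d] unfolding satchain_def by (cases d) auto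
    then show "(\<Sum>i\<in>?I (word d). (-1) ^ i) = (0::int)"
      by (rule alternating_sum_split_eq_0)
  qed
  finally show ?thesis .
qed

lemma af_chains_bot: "af_chains z0 = {[z0]}"
proof -
  have "c = [z0]" if c: "satchain P le z0 z0 c" for c
  proof -
    have "length c = Suc 0" using satchain_rk[OF c] rk_bot by simp
    then obtain a where "c = [a]" by (auto simp: length_Suc_conv)
    then show ?thesis using c unfolding satchain_def by simp
  qed
  then show ?thesis
    unfolding af_chains_def using satchain_single[OF bot_in] by (intro equalityI subsetI) simp_all
qed

section \<open>Quadratic exchanges and the equivalence they generate\<close>

lemma exchE:
  assumes "exch c d"
  obtains u a b e v z where "c = u @ a # b # e # v" "d = u @ a # z # e # v"
    "llt (lam a b) (lam b e)" "lam a z = lam b e" "lam z e = lam a b"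
    "covers P le a z" "covers P le z e"
proof -
  obtain i z where i: "0 < i" "Suc i < length c" "d = c[i := z]"
    "llt (lam (c ! (i - 1)) (c ! i)) (lam (c ! i) (c ! Suc i))"
    "lam (c ! (i - 1)) z = lam (c ! i) (c ! Suc i)"
    "lam z (c ! Suc i) = lam (c ! (i - 1)) (c ! i)"
    "covers P le (c ! (i - 1)) z" "covers P le z (c ! Suc i)"
    using assms unfolding qexch_def by blast
  obtain p where "i = Suc p" using i(1) by (cases i) auto
  then have p: "Suc (Suc p) < length c" "d = c[Suc p := z]"
    "llt (lam (c ! p) (c ! Suc p)) (lam (c ! Suc p) (c ! Suc (Suc p)))"
    "lam (c ! p) z = lam (c ! Suc p) (c ! Suc (Suc p))"
    "lam z (c ! Suc (Suc p)) = lam (c ! p) (c ! Suc p)"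
    "covers P le (c ! p) z" "covers P le z (c ! Suc (Suc p))"
    using i by simp_all
  have c: "c = take p c @ c ! p # c ! Suc p # c ! Suc (Suc p) # drop (Suc (Suc (Suc p))) c"
    using p(1) by (simp add: Cons_nth_drop_Suc)
  have "d = (take p c @ c ! p # c ! Suc p # c ! Suc (Suc p) # drop (Suc (Suc (Suc p))) c)[Suc p := z]"
    using c p(2) by simp
  then have "d = take p c @ c ! p # z # c ! Suc (Suc p) # drop (Suc (Suc (Suc p))) c"
    using p(1) by (simp add: list_update_append)
  then show ?thesis using that[OF c] p by blast
qed

lemma chains_exchange:
  assumes "u @ a # b # e # v \<in> rooted_chains" "covers P le a z" "covers P le z e"
  shows "u @ a # z # e # v \<in> rooted_chains"
proof -
  have "z \<in> P" using assms(2) unfolding covers_def by blast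
  then show ?thesis
    using assms unfolding mem_chains_iff satchain_def
    by (cases u) (auto simp: successively_append_iff successively_Cons hd_append)
qed

lemma exchI:
  assumes "u @ a # b # e # v \<in> rooted_chains" "llt (lam a b) (lam b e)" "lam a z = lam b e"
    "lam z e = lam a b" "covers P le a z" "covers P le z e"
  shows "exch (u @ a # b # e # v) (u @ a # z # e # v)"
  unfolding qexch_def
proof (intro conjI exI)
  show "u @ a # z # e # v = (u @ a # b # e # v)[Suc (length u) := z]"
    by (simp add: list_update_append)
qed (use assms chains_exchange[OF assms(1,5,6)] in \<open>auto simp: nth_append\<close>)

lemma exch_exists:
  assumes c: "u @ a # b # e # v \<in> rooted_chains" and asc: "llt (lam a b) (lam b e)"
  obtains z where "exch (u @ a # b # e # v) (u @ a # z # e # v)"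
    "lam a z = lam b e" "lam z e = lam a b"
proof -
  let ?c = "u @ a # b # e # v"
  have nth: "?c ! (Suc (length u) - 1) = a" "?c ! Suc (length u) = b" "?c ! Suc (Suc (length u)) = e"
    by (auto simp: nth_append)
  have sat: "satchain P le z0 (last ?c) ?c"
    using c mem_chains_iff by blast
  have "rank_two_switching P le z0 lam llt"
    using ew unfolding EW_labeling_def by blast
  from this[unfolded rank_two_switching_def, rule_format, OF sat, of "Suc (length u)", unfolded nth]
  have "\<exists>!z. covers P le a z \<and> covers P le z e \<and> lam a z = lam b e \<and> lam z e = lam a b"
    using asc by simp
  then show ?thesis using that exchI[OF c asc] by blast
qed

lemma exch_invariants:
  assumes "exch c d"
  shows "length c = length d" "last c = last d" "trace_eq (word c) (word d)"
proof -
  from assms obtain u a b e v z where *: "c = u @ a # b # e # v" "d = u @ a # z # e # v"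
    "llt (lam a b) (lam b e)" "lam a z = lam b e" "lam z e = lam a b"
    by (rule exchE)
  show "length c = length d" "last c = last d" using * by auto
  show "trace_eq (word c) (word d)"
    using trace_eq_swap[OF *(3), of "word (u @ [a])" "word (e # v)"] *
    by (simp add: lword_append_Cons)
qed

lemma exch_append:
  assumes "exch c d" "c @ t \<in> rooted_chains"
  shows "exch (c @ t) (d @ t)"
proof -
  from assms(1) obtain u a b e v z where *: "c = u @ a # b # e # v" "d = u @ a # z # e # v"
    "llt (lam a b) (lam b e)" "lam a z = lam b e" "lam z e = lam a b"
    "covers P le a z" "covers P le z e"
    by (rule exchE)
  then show ?thesis using exchI[of u a b e "v @ t" z] assms(2) by simp
qed

lemma chains_append_cong:
  assumes "c @ t \<in> rooted_chains" "d \<in> rooted_chains" "last c = last d" "c \<noteq> []"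
  shows "d @ t \<in> rooted_chains"
proof (cases "t = []")
  case False
  then show ?thesis
    using assms unfolding mem_chains_iff satchain_def
    by (auto simp: successively_append_iff hd_append)
qed (use assms in simp)

lemma exch_rooted: "exch c d \<Longrightarrow> c \<in> rooted_chains \<and> d \<in> rooted_chains"
  unfolding qexch_def by blast

lemma relI_exch:
  assumes "exch c d"
  shows "(c, d) \<in> rel"
proof -
  have "symclp exch c d" using assms by (simp add: symclp_def)
  then show ?thesis using exch_rooted[OF assms] unfolding qrel_def by auto
qed

lemma equiv_rel: "equiv rooted_chains rel"
proof (rule equivI)
  show "rel \<subseteq> rooted_chains \<times> rooted_chains" unfolding qrel_def by blast
  show "refl_on rooted_chains rel" unfolding refl_on_def qrel_def by blast
  show "sym rel"
    using symp_rtranclp_symclp[of exch] unfolding sym_def qrel_def symp_def by blast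
  show "trans rel" unfolding trans_def qrel_def by (auto intro: rtranclp_trans)
qed

lemmas rel_refl = equiv_class_self[OF equiv_rel]

lemma rel_sym: "(c, d) \<in> rel \<Longrightarrow> (d, c) \<in> rel"
  using equiv_rel unfolding equiv_def sym_def by blast

lemma rel_trans: "(c, d) \<in> rel \<Longrightarrow> (d, e) \<in> rel \<Longrightarrow> (c, e) \<in> rel"
  using equiv_rel unfolding equiv_def trans_def by blast

lemma rel_chains: "(c, d) \<in> rel \<Longrightarrow> c \<in> rooted_chains \<and> d \<in> rooted_chains"
  unfolding qrel_def by blast

lemma rel_induct [consumes 1, case_names refl step]:
  assumes "(c, d) \<in> rel"
    and "R c"
    and "\<And>d e. (c, d) \<in> rel \<Longrightarrow> R d \<Longrightarrow> exch d e \<or> exch e d \<Longrightarrow> R e"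
  shows "R d"
proof -
  have "(symclp exch)\<^sup>*\<^sup>* c d" "c \<in> rooted_chains"
    using assms(1) unfolding qrel_def by auto
  then have "(c, d) \<in> rel \<and> R d"
  proof (induction rule: rtranclp_induct)
    case base
    then show ?case using assms(2) unfolding qrel_def by auto
  next
    case (step d e)
    then have "exch d e \<or> exch e d" by (auto simp: symclp_def)
    then have "(d, e) \<in> rel" using relI_exch rel_sym by blast
    then show ?case
      using step assms(3) \<open>exch d e \<or> exch e d\<close> rel_trans by blast
  qed
  then show ?thesis ..
qed

lemma rel_invariants:
  assumes "(c, d) \<in> rel"
  shows "length d = length c \<and> last d = last c \<and> trace_eq (word c) (word d)"
  using assms
proof (induction rule: rel_induct)
  case (step d e)
  have "length e = length d \<and> last e = last d \<and> trace_eq (word d) (word e)"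
    using \<open>exch d e \<or> exch e d\<close> exch_invariants[of d e] exch_invariants[of e d] trace_eq_sym
    by auto
  then show ?case
    using \<open>length d = length c \<and> last d = last c \<and> trace_eq (word c) (word d)\<close>
      trace_eq_trans by auto
qed (simp add: trace_eq_refl)

text \<open>An exchange keeps the last element, so it remains an exchange after appending
  \<open>t\<close>. Hence extending a chain is compatible with the classes, on which the description
  of \<open>leQ\<close> rests.\<close>

lemma rel_append:
  assumes "(c, d) \<in> rel" "c @ t \<in> rooted_chains"
  shows "(c @ t, d @ t) \<in> rel"
  using assms(1)
proof (induction rule: rel_induct)
  case refl
  then show ?case using equiv_rel assms(2) unfolding equiv_def refl_on_def by blast
next
  case (step d e)
  note IH = \<open>(c @ t, d @ t) \<in> rel\<close> and ex = \<open>exch d e \<or> exch e d\<close>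
  have dt: "d @ t \<in> rooted_chains" using IH rel_chains by blast
  have "d \<in> rooted_chains" "e \<in> rooted_chains" "last d = last e"
    using ex exch_rooted exch_invariants(2)[of d e] exch_invariants(2)[of e d] by auto
  moreover from this have "d \<noteq> []" unfolding mem_chains_iff satchain_def by blast
  ultimately have "e @ t \<in> rooted_chains" using chains_append_cong dt by blast
  then have "(d @ t, e @ t) \<in> rel"
    using ex exch_append dt relI_exch rel_sym by blast
  then show ?case using IH rel_trans by blast
qed

text \<open>Forward exchanges straighten the part above \<open>a\<close> while
  \<open>u @ [a]\<close> stays fixed; each one lowers the number of ascending pairs. The prefix is
  carried along because switching is assumed for chains from the bottom. Empty \<open>u\<close>
  gives ascent-free representatives, general \<open>u\<close> serves the Moebius function of the
  quotient.\<close>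

lemma ascent_free_suffix_exists:
  assumes "u @ a # v \<in> rooted_chains"
  shows "\<exists>v'. (u @ a # v, u @ a # v') \<in> rel \<and> ascent_free (word (a # v'))"
  using assms
proof (induction "num_ascending_pairs (word (a # v))" arbitrary: v rule: less_induct)
  case less
  show ?case
  proof (cases "ascent_free (word (a # v))")
    case True
    then show ?thesis
      using equiv_rel less.prems unfolding equiv_def refl_on_def by blast
  next
    case False
    then obtain u1 a1 b1 e1 v1 where s: "a # v = u1 @ a1 # b1 # e1 # v1"
      and asc: "llt (lam a1 b1) (lam b1 e1)"
      by (rule not_ascent_free_split)
    have eq: "u @ a # v = (u @ u1) @ a1 # b1 # e1 # v1" using s by simp
    obtain z where z: "exch ((u @ u1) @ a1 # b1 # e1 # v1) ((u @ u1) @ a1 # z # e1 # v1)"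
      "lam a1 z = lam b1 e1" "lam z e1 = lam a1 b1"
      using exch_exists[OF less.prems[unfolded eq] asc] by blast
    \<comment> \<open>The exchange replaces an inner element of \<open>a # v\<close>, so the new
      chain still passes through \<open>a\<close>.\<close>
    obtain v2 where v2: "u1 @ a1 # z # e1 # v1 = a # v2"
      using s by (cases u1) auto
    have e: "exch (u @ a # v) (u @ a # v2)"
      using z(1) eq v2 by simp
    have "num_ascending_pairs (word (a # v2)) < num_ascending_pairs (word (a # v))"
      using num_ascending_pairs_swap[OF asc, of "word (u1 @ [a1])" "word (e1 # v1)"] z
      unfolding s v2[symmetric] by (simp add: lword_append_Cons)
    then obtain v' where "(u @ a # v2, u @ a # v') \<in> rel" "ascent_free (word (a # v'))"
      using less.hyps[of v2] e unfolding qexch_def by blast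
    then show ?thesis using relI_exch[OF e] rel_trans by blast
  qed
qed

lemma ascent_free_unique:
  assumes "(c, d) \<in> rel" "ascent_free (word c)" "ascent_free (word d)"
  shows "c = d"
proof -
  have "word c = word d"
    using trace_eq_ascent_free_unique rel_invariants[OF assms(1)] assms(2,3) by blast
  then show ?thesis
    using word_inj[of z0 "last c" c d] rel_invariants[OF assms(1)] rel_chains[OF assms(1)]
    unfolding mem_chains_iff by simp
qed

lemma chain_cases:
  assumes "c \<in> rooted_chains"
  obtains v where "c = z0 # v"
  using assms unfolding mem_chains_iff satchain_def by (metis list.collapse)

lemma ascent_free_exists:
  assumes "c \<in> rooted_chains"
  shows "\<exists>d. (c, d) \<in> rel \<and> ascent_free (word d)"
proof -
  obtain v where "c = [] @ z0 # v" using chain_cases[OF assms] by auto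
  then show ?thesis using ascent_free_suffix_exists[of "[]" z0 v] assms by auto
qed

section \<open>The classes as a ranked poset\<close>

abbreviation cls :: "'a list \<Rightarrow> 'a list set" where
  "cls c \<equiv> rel `` {c}"

lemma cls_in_Q: "c \<in> rooted_chains \<Longrightarrow> cls c \<in> Q"
  unfolding Qcar_def by (rule quotientI)

lemma mem_cls: "c \<in> rooted_chains \<Longrightarrow> c \<in> cls c"
  using rel_refl by simp

lemma Q_eq_cls: "X \<in> Q \<Longrightarrow> c \<in> X \<Longrightarrow> X = cls c"
  unfolding Qcar_def using equiv_rel
  by (metis Image_singleton_iff equiv_class_eq quotientE)

lemma Q_mem_chains: "X \<in> Q \<Longrightarrow> c \<in> X \<Longrightarrow> c \<in> rooted_chains"
  using in_quotient_imp_subset[OF equiv_rel] unfolding Qcar_def by blast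

lemma Q_nonempty: "X \<in> Q \<Longrightarrow> \<exists>c. c \<in> X"
  using in_quotient_imp_non_empty[OF equiv_rel] unfolding Qcar_def by blast

lemma Q_rel: "X \<in> Q \<Longrightarrow> c \<in> X \<Longrightarrow> d \<in> X \<longleftrightarrow> (c, d) \<in> rel"
  using Q_eq_cls by blast

lemma cls_eq_iff: "c \<in> rooted_chains \<Longrightarrow> d \<in> rooted_chains \<Longrightarrow> cls c = cls d \<longleftrightarrow> (c, d) \<in> rel"
  using eq_equiv_class_iff[OF equiv_rel] .

definition rkQ :: "'a list set \<Rightarrow> nat" where
  "rkQ X = length (SOME c. c \<in> X) - 1"

lemma length_mem_Q:
  assumes "X \<in> Q" "c \<in> X"
  shows "length c = Suc (rkQ X)"
proof -
  have "(SOME c. c \<in> X) \<in> X" using assms(2) by (rule someI)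
  then have "length (SOME c. c \<in> X) = length c"
    using Q_rel[OF assms] rel_invariants by blast
  moreover have "c \<noteq> []" using Q_mem_chains[OF assms] chain_cases by blast
  ultimately show ?thesis unfolding rkQ_def by simp
qed

lemma length_cls: "c \<in> rooted_chains \<Longrightarrow> length c = Suc (rkQ (cls c))"
  using length_mem_Q cls_in_Q mem_cls by blast

text \<open>The transitive closure collapses to one step: an extension of one representative of the
  middle class can be transported to any other representative by \<open>rel_append\<close>.\<close>

lemma leQ_iff: "leQ X Y \<longleftrightarrow> X \<in> Q \<and> Y \<in> Q \<and> (\<exists>c t. c \<in> X \<and> c @ t \<in> Y)"
proof
  assume "leQ X Y"
  then show "X \<in> Q \<and> Y \<in> Q \<and> (\<exists>c t. c \<in> X \<and> c @ t \<in> Y)"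
    unfolding Qle_def
  proof (induction rule: tranclp_induct)
    case (base Y)
    then obtain c d where cd: "c \<in> X" "d \<in> Y" "set c \<subseteq> set d" "X \<in> Q" "Y \<in> Q" by blast
    then obtain t where "d = c @ t"
      using satchain_prefix[of "last c" c "last d" d] Q_mem_chains mem_chains_iff by blast
    then show ?case using cd by blast
  next
    case (step Y Z)
    then obtain c d d' e t where *: "c \<in> X" "c @ t \<in> Y" "d' \<in> Y" "e \<in> Z" "set d' \<subseteq> set e"
      "X \<in> Q" "Y \<in> Q" "Z \<in> Q" by blast
    then obtain s where "e = d' @ s"
      using satchain_prefix[of "last d'" d' "last e" e] Q_mem_chains mem_chains_iff by blast
    then have "(d' @ s, (c @ t) @ s) \<in> rel"
      using rel_append Q_rel[OF \<open>Y \<in> Q\<close> \<open>d' \<in> Y\<close>] * Q_mem_chains by blast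
    then have "c @ t @ s \<in> Z"
      using Q_rel[OF \<open>Z \<in> Q\<close> \<open>e \<in> Z\<close>] \<open>e = d' @ s\<close> by simp
    then show ?case using * by blast
  qed
next
  assume "X \<in> Q \<and> Y \<in> Q \<and> (\<exists>c t. c \<in> X \<and> c @ t \<in> Y)"
  then have "X \<in> Q \<and> Y \<in> Q \<and> (\<exists>c\<in>X. \<exists>d\<in>Y. set c \<subseteq> set d)"
    by (metis set_append sup_ge1)
  then show "leQ X Y" unfolding Qle_def by (rule tranclp.r_into_trancl)
qed

lemma chains_prefix: "c @ t \<in> rooted_chains \<Longrightarrow> c \<noteq> [] \<Longrightarrow> c \<in> rooted_chains"
  unfolding mem_chains_iff satchain_def by (auto simp: successively_append_iff)

lemma leQ_cls: "c @ t \<in> rooted_chains \<Longrightarrow> c \<noteq> [] \<Longrightarrow> leQ (cls c) (cls (c @ t))"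
  using leQ_iff chains_prefix[of c t] cls_in_Q mem_cls by blast

lemma rkQ_mono:
  assumes "leQ X Y"
  shows "rkQ X \<le> rkQ Y" "rkQ X = rkQ Y \<Longrightarrow> X = Y"
proof -
  obtain c t where c: "X \<in> Q" "Y \<in> Q" "c \<in> X" "c @ t \<in> Y"
    using assms leQ_iff by blast
  then have l: "length c = Suc (rkQ X)" "length c + length t = Suc (rkQ Y)"
    using length_mem_Q[OF c(1,3)] length_mem_Q[OF c(2,4)] by simp_all
  then show "rkQ X \<le> rkQ Y" by linarith
  assume "rkQ X = rkQ Y"
  then have "t = []" using l by simp
  then show "X = Y" using c Q_eq_cls by (metis append_Nil2)
qed

lemma chains_bot: "[z0] \<in> rooted_chains"
  using satchain_single[OF bot_in, of le] unfolding Cch_def by blast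

lemma finite_chains: "finite rooted_chains"
proof -
  have "rooted_chains = (\<Union>y\<in>P. {c. satchain P le z0 y c})"
    unfolding Cch_def using satchain_in(2) by blast
  then show ?thesis using finite_carrier finite_satchains by simp
qed

lemma leQ_trans:
  assumes "leQ X Y" "leQ Y Z"
  shows "leQ X Z"
  using assms unfolding Qle_def by (rule tranclp_trans)

sublocale dual: ranked_poset Q leQ botQ rkQ
proof
  show "finite Q"
    unfolding Qcar_def
    by (rule finite_quotient[OF finite_chains]) (use equiv_rel in \<open>auto simp: equiv_def\<close>)
  show "botQ \<in> Q"
    unfolding Qbot_def using chains_bot by (rule cls_in_Q)
  show "partial_order_on Q leQ"
    unfolding partial_order_on_def
  proof (intro conjI ballI impI)
    fix X assume X: "X \<in> Q"
    then obtain c where "c \<in> X" using Q_nonempty by blast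
    then have "c @ [] \<in> X" by simp
    then show "leQ X X" using X \<open>c \<in> X\<close> leQ_iff by blast
  next
    fix X Y assume "leQ X Y \<and> leQ Y X"
    then show "X = Y" using rkQ_mono[of X Y] rkQ_mono(1)[of Y X] by simp
  next
    fix X Y Z assume "leQ X Y \<and> leQ Y Z"
    then show "leQ X Z" using leQ_trans by blast
  qed
  show "leQ botQ X" if X: "X \<in> Q" for X
  proof -
    obtain c where c: "c \<in> X" using Q_nonempty[OF X] by blast
    obtain v where "c = z0 # v"
      using Q_mem_chains[OF X c] by (rule chain_cases)
    then have "c = [z0] @ v" by simp
    then have "leQ (cls [z0]) (cls c)"
      using leQ_cls[of "[z0]" v] Q_mem_chains[OF X c] by blast
    then show ?thesis
      using Q_eq_cls[OF X c] unfolding Qbot_def by metis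
  qed
  show "rkQ botQ = 0"
    using length_cls[OF chains_bot] unfolding Qbot_def by simp
  show "rkQ Y = Suc (rkQ X)" if cov: "covers Q leQ X Y" for X Y
  proof -
    have "leQ X Y" "X \<noteq> Y"
      using cov unfolding covers_def strict_def by simp_all
    then obtain c t where c: "X \<in> Q" "Y \<in> Q" "c \<in> X" "c @ t \<in> Y"
      using leQ_iff[of X Y] by blast
    note X = Q_eq_cls[OF c(1,3)] and Y = Q_eq_cls[OF c(2,4)]
    note ch = Q_mem_chains[OF c(1,3)] Q_mem_chains[OF c(2,4)]
    have "c \<noteq> []" using ch(1) chain_cases by blast
    \<comment> \<open>The class of \<open>c @ [s]\<close> lies between \<open>X\<close> and
      \<open>Y\<close> and differs from \<open>X\<close> by its rank, so a cover forces it to be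
      \<open>Y\<close>.\<close>
    obtain s t' where t: "t = s # t'"
      using \<open>X \<noteq> Y\<close> X Y by (cases t) simp_all
    have ct: "c @ t = (c @ [s]) @ t'" using t by simp
    have cs: "c @ [s] \<in> rooted_chains"
      using ch(2) unfolding ct by (rule chains_prefix) simp
    have "leQ X (cls (c @ [s]))"
      unfolding X by (rule leQ_cls[OF cs \<open>c \<noteq> []\<close>])
    moreover have "leQ (cls (c @ [s])) Y"
      unfolding Y ct by (rule leQ_cls) (use ch(2) ct in simp_all)
    moreover have rk: "rkQ (cls (c @ [s])) = Suc (rkQ X)"
      using length_cls[OF cs] length_mem_Q[OF c(1,3)] by simp
    then have "cls (c @ [s]) \<noteq> X" by (metis n_not_Suc_n)
    ultimately have "cls (c @ [s]) = Y"
      using cov cls_in_Q[OF cs] unfolding covers_def strict_def by metis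
    then show ?thesis using rk by metis
  qed
qed

section \<open>Moebius function of the poset of classes\<close>

definition has_increasing :: "'a list set \<Rightarrow> bool" where
  "has_increasing X \<longleftrightarrow> (\<exists>c\<in>X. increasing (word c))"

text \<open>The members of \<open>Y\<close> with a cut into an increasing lower and an ascent-free
  upper part correspond to the classes below \<open>Y\<close> that contain an increasing chain: the
  lower part represents the class, and the upper part is the unique ascent-free way to complete it
  inside \<open>Y\<close>.\<close>

lemma sum_has_increasing_eq_0:
  assumes Y: "Y \<in> Q" "Y \<noteq> botQ"
  shows "(\<Sum>Z | Z \<in> Q \<and> leQ Z Y. if has_increasing Z then (-1) ^ rkQ Z else 0) = (0::int)"
proof -
  \<comment> \<open>The double negation makes this the set of
    \<open>alternating_sum_split_eq_0\<close> for the complement of \<open>llt\<close>.\<close>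
  let ?I = "\<lambda>w. {i. i \<le> length w \<and> successively (\<lambda>a b. \<not> \<not> llt a b) (take i w) \<and>
    ascent_free (drop i w)}"
  let ?T = "SIGMA d:Y. ?I (word d)"
  let ?S = "{Z. Z \<in> Q \<and> leQ Z Y \<and> has_increasing Z}"
  let ?h = "\<lambda>(d, i). cls (take (Suc i) d)"
  have T: "d \<in> rooted_chains" "i < length d" "take (Suc i) d \<in> rooted_chains" "increasing (word (take (Suc i) d))"
    "rkQ (?h (d, i)) = i"
    if "(d, i) \<in> ?T" for d i
  proof -
    show d: "d \<in> rooted_chains" using that Q_mem_chains[OF Y(1)] by simp
    then have "d \<noteq> []" using chain_cases by blast
    then show i: "i < length d" using that by (cases d) (auto simp: length_lword)
    have "take (Suc i) d @ drop (Suc i) d \<in> rooted_chains" using d by simp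
    then show c: "take (Suc i) d \<in> rooted_chains" by (rule chains_prefix) (use i in auto)
    show "increasing (word (take (Suc i) d))" using that by (simp add: lword_take)
    show "rkQ (?h (d, i)) = i" using length_cls[OF c] i by simp
  qed
  have bij: "bij_betw ?h ?T ?S"
    unfolding bij_betw_def
  proof
    show "inj_on ?h ?T"
    proof (rule inj_onI)
      fix s s' assume s: "s \<in> ?T" "s' \<in> ?T" "?h s = ?h s'"
      obtain d i d' i' where eq: "s = (d, i)" "s' = (d', i')" by (cases s; cases s')
      note T1 = T[OF s(1)[unfolded eq(1)]] and T2 = T[OF s(2)[unfolded eq(2)]]
      have "i = i'" using T1(5) T2(5) s(3) eq by simp
      have r: "(take (Suc i) d, take (Suc i) d') \<in> rel"
        using s(3) cls_eq_iff T1(3) T2(3) \<open>i = i'\<close> unfolding eq by simp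
      have "last (take (Suc i) d) = last (take (Suc i) d')"
        using rel_invariants[OF r] by simp
      then have pre: "take (Suc i) d = take (Suc i) d'"
        using increasing_chain_unique[of z0 "last (take (Suc i) d)" "take (Suc i) d" "take (Suc i) d'"]
          T1(3,4) T2(3,4) \<open>i = i'\<close> unfolding mem_chains_iff by simp
      have "(d, d') \<in> rel"
        using s(1,2) Q_rel[OF Y(1)] unfolding eq by auto
      then have tr: "trace_eq (word d) (word d')" and l: "last d = last d'"
        using rel_invariants by auto
      have pw: "take i (word d) = take i (word d')"
        using pre by (metis lword_take)
      \<comment> \<open>After cancelling the common lower part, the upper words are ascent-free and
        lie in one trace class, hence coincide.\<close>
      have "trace_eq (take i (word d) @ drop i (word d)) (take i (word d') @ drop i (word d'))"
        using tr by simp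
      then have "trace_eq (drop i (word d)) (drop i (word d'))"
        by (rule trace_eq_append_cancel[rotated]) (simp add: pw trace_eq_refl)
      then have "drop i (word d) = drop i (word d')"
        by (rule trace_eq_ascent_free_unique) (use s(1,2) \<open>i = i'\<close> eq in auto)
      then have "word d = word d'" using pw by (metis append_take_drop_id)
      then have "d = d'"
        using word_inj[of z0 "last d" d d'] T1(1) T2(1) l unfolding mem_chains_iff by simp
      then show "s = s'" using eq \<open>i = i'\<close> by simp
    qed
    show "?h ` ?T = ?S"
    proof (intro equalityI subsetI)
      fix Z assume "Z \<in> ?h ` ?T"
      then obtain d i where d: "(d, i) \<in> ?T" "Z = cls (take (Suc i) d)" by auto
      have "Y = cls d" using Q_eq_cls[OF Y(1)] d(1) by simp
      moreover have "leQ (cls (take (Suc i) d)) (cls (take (Suc i) d @ drop (Suc i) d))"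
        using T[OF d(1)] by (intro leQ_cls) auto
      ultimately have "leQ Z Y" using d(2) by simp
      then show "Z \<in> ?S"
        using T[OF d(1)] cls_in_Q mem_cls unfolding d(2) has_increasing_def by blast
    next
      fix Z assume Z: "Z \<in> ?S"
      then obtain c where c: "c \<in> Z" "increasing (word c)" unfolding has_increasing_def by blast
      obtain c' t where c': "c' \<in> Z" "c' @ t \<in> Y" using Z leQ_iff by blast
      have "(c', c) \<in> rel" using Z c c' Q_rel by blast
      then have "(c' @ t, c @ t) \<in> rel"
        using c'(2) Q_mem_chains[OF Y(1)] rel_append by blast
      then have ct: "c @ t \<in> Y" using Q_rel[OF Y(1) c'(2)] by simp
      have "c \<noteq> []" using c(1) Z Q_mem_chains chain_cases by blast
      then obtain u a where ua: "c = u @ [a]" by (metis append_butlast_last_id)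
      have "u @ a # t \<in> rooted_chains" using ct Q_mem_chains[OF Y(1)] ua by simp
      then obtain v where v: "(u @ a # t, u @ a # v) \<in> rel" "ascent_free (word (a # v))"
        using ascent_free_suffix_exists by blast
      have "u @ a # v \<in> Y" using v(1) Q_rel[OF Y(1) ct] ua by simp
      moreover have "word (u @ a # v) = word c @ word (a # v)"
        using lword_append[of lam u a v] ua by simp
      moreover have "length (word c) = length u" using ua by (simp add: length_lword)
      ultimately have "(u @ a # v, length u) \<in> ?T"
        using c(2) v(2) by simp
      moreover have "Z = ?h (u @ a # v, length u)"
        using Q_eq_cls[of Z c] Z c(1) ua by simp
      ultimately show "Z \<in> ?h ` ?T" by blast
    qed
  qed
  have finY: "finite Y"
    using finite_chains Q_mem_chains[OF Y(1)] by (meson finite_subset subsetI)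
  have finI: "finite (?I w)" for w :: "'l list"
    by (rule finite_subset[of _ "{..length w}"]) auto
  have "(\<Sum>Z | Z \<in> Q \<and> leQ Z Y. if has_increasing Z then (-1) ^ rkQ Z else 0) =
      (\<Sum>Z\<in>?S. (-1::int) ^ rkQ Z)"
    using dual.finite_carrier by (intro sum.mono_neutral_cong_right) auto
  also have "\<dots> = (\<Sum>t\<in>?T. (-1) ^ rkQ (?h t))"
    by (rule sum.reindex_bij_betw[OF bij, symmetric])
  also have "\<dots> = (\<Sum>(d, i)\<in>?T. (-1) ^ i)"
    using T(5) by (intro sum.cong) auto
  also have "\<dots> = (\<Sum>d\<in>Y. \<Sum>i\<in>?I (word d). (-1) ^ i)"
    using finY finI by (subst sum.Sigma) auto
  also have "\<dots> = 0"
  proof (rule sum.neutral, clarify)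
    fix d assume d: "d \<in> Y"
    obtain v where v: "d = z0 # v" using Q_mem_chains[OF Y(1) d] chain_cases by blast
    have "v \<noteq> []"
      using Y(2) Q_eq_cls[OF Y(1) d] v unfolding Qbot_def by auto
    then have "word d \<noteq> []" using v by (cases v) auto
    then show "(\<Sum>i\<in>?I (word d). (-1) ^ i) = (0::int)"
      by (rule alternating_sum_split_eq_0)
  qed
  finally show ?thesis .
qed

lemma has_increasing_bot: "has_increasing botQ"
  using mem_cls[OF chains_bot] unfolding has_increasing_def Qbot_def by (rule rev_bexI) simp

section \<open>Counting by rank and the duality\<close>

lemma card_rkQ_eq: "card {X \<in> Q. rkQ X = k} = (\<Sum>x | x \<in> P \<and> rk x = k. card (af_chains x))"
proof -
  let ?A = "\<Union>x\<in>{x \<in> P. rk x = k}. af_chains x"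
  have A: "c \<in> ?A \<longleftrightarrow> c \<in> rooted_chains \<and> length c = Suc k \<and> ascent_free (word c)" for c
  proof
    assume "c \<in> ?A"
    then show "c \<in> rooted_chains \<and> length c = Suc k \<and> ascent_free (word c)"
      using satchain_rk unfolding af_chains_def Cch_def by auto
  next
    assume c: "c \<in> rooted_chains \<and> length c = Suc k \<and> ascent_free (word c)"
    then show "c \<in> ?A"
      using satchain_rk[of "last c" c] satchain_in(2)[of z0 "last c" c]
      unfolding mem_chains_iff af_chains_def by auto
  qed
  have "bij_betw cls ?A {X \<in> Q. rkQ X = k}"
    unfolding bij_betw_def
  proof
    show "inj_on cls ?A"
    proof (rule inj_onI)
      fix c d assume "c \<in> ?A" "d \<in> ?A" "cls c = cls d"
      then show "c = d"
        using A[of c] A[of d] cls_eq_iff[of c d] ascent_free_unique[of c d] by blast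
    qed
    show "cls ` ?A = {X \<in> Q. rkQ X = k}"
    proof (intro equalityI subsetI)
      fix X assume "X \<in> cls ` ?A"
      then obtain c where c: "c \<in> ?A" "X = cls c" by (rule imageE)
      then show "X \<in> {X \<in> Q. rkQ X = k}"
        using A[of c] cls_in_Q[of c] length_cls[of c] by simp
    next
      fix X assume X: "X \<in> {X \<in> Q. rkQ X = k}"
      then obtain c where c: "c \<in> X" using Q_nonempty by blast
      then have "c \<in> rooted_chains" using Q_mem_chains X by blast
      then obtain d where d: "(c, d) \<in> rel" "ascent_free (word d)"
        using ascent_free_exists by blast
      then have dX: "d \<in> X" using Q_rel[of X c d] c X by blast
      then have "d \<in> ?A"
        using A[of d] length_mem_Q[of X d] Q_mem_chains[of X d] d(2) X by blast
      moreover have "X = cls d" using Q_eq_cls[of X d] X dX by blast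
      ultimately show "X \<in> cls ` ?A" by (rule rev_image_eqI)
    qed
  qed
  then have "card {X \<in> Q. rkQ X = k} = card ?A"
    by (rule bij_betw_same_card[symmetric])
  also have "\<dots> = (\<Sum>x | x \<in> P \<and> rk x = k. card (af_chains x))"
  proof (rule card_UN_disjoint)
    have last: "last c = x" if "c \<in> af_chains x" for c x
      using that unfolding af_chains_def satchain_def by simp
    show "\<forall>x\<in>{x \<in> P. rk x = k}. \<forall>y\<in>{x \<in> P. rk x = k}. x \<noteq> y \<longrightarrow> af_chains x \<inter> af_chains y = {}"
    proof (intro ballI impI equals0I)
      fix x y c assume "x \<noteq> y" "c \<in> af_chains x \<inter> af_chains y"
      then show False using last[of c x] last[of c y] by simp
    qed
  qed (use finite_carrier finite_af_chains in auto)
  finally show ?thesis .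
qed

text \<open>The chains of a class share their endpoint, and each element of \<open>P\<close> is the
  endpoint of exactly one increasing chain from the bottom.\<close>

lemma card_has_increasing_eq:
  "card {X \<in> Q. rkQ X = k \<and> has_increasing X} = card {x \<in> P. rk x = k}"
proof -
  let ?inc = "\<lambda>x c. satchain P le z0 x c \<and> increasing (word c)"
  define f where "f x = (SOME c. ?inc x c)" for x
  have f: "?inc x (f x)" if "x \<in> P" for x
    unfolding f_def by (rule someI_ex) (use that increasing_chain_exists bot_in bot_le in blast)
  have fc: "f x \<in> rooted_chains" "last (f x) = x" if "x \<in> P" for x
    using f[OF that] unfolding mem_chains_iff satchain_def by auto
  have "bij_betw (\<lambda>x. cls (f x)) {x \<in> P. rk x = k} {X \<in> Q. rkQ X = k \<and> has_increasing X}"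
    unfolding bij_betw_def
  proof
    show "inj_on (\<lambda>x. cls (f x)) {x \<in> P. rk x = k}"
    proof (rule inj_onI)
      fix x y assume "x \<in> {x \<in> P. rk x = k}" "y \<in> {x \<in> P. rk x = k}" "cls (f x) = cls (f y)"
      then have "(f x, f y) \<in> rel" "last (f x) = x" "last (f y) = y"
        using fc cls_eq_iff by auto
      then show "x = y" using rel_invariants[of "f x" "f y"] by simp
    qed
    show "(\<lambda>x. cls (f x)) ` {x \<in> P. rk x = k} = {X \<in> Q. rkQ X = k \<and> has_increasing X}"
    proof (intro equalityI subsetI)
      fix X assume "X \<in> (\<lambda>x. cls (f x)) ` {x \<in> P. rk x = k}"
      then obtain x where x: "x \<in> P" "rk x = k" "X = cls (f x)" by blast
      then have "rkQ X = k"
        using satchain_rk[of x "f x"] f[OF x(1)] length_cls[OF fc(1)[OF x(1)]] by simp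
      then show "X \<in> {X \<in> Q. rkQ X = k \<and> has_increasing X}"
        using x f fc cls_in_Q mem_cls unfolding has_increasing_def by blast
    next
      fix X assume "X \<in> {X \<in> Q. rkQ X = k \<and> has_increasing X}"
      then obtain c where c: "X \<in> Q" "rkQ X = k" "c \<in> X" "increasing (word c)"
        unfolding has_increasing_def by blast
      then have s: "satchain P le z0 (last c) c"
        using Q_mem_chains mem_chains_iff by blast
      have l: "last c \<in> P" "rk (last c) = k"
        using satchain_in(2)[OF s] satchain_rk[OF s] length_mem_Q[OF c(1,3)] c(2) by auto
      have "c = f (last c)"
        using increasing_chain_unique[OF s] f[OF l(1)] c(4) by blast
      then have "X = cls (f (last c))" using Q_eq_cls[OF c(1,3)] by simp
      then show "X \<in> (\<lambda>x. cls (f x)) ` {x \<in> P. rk x = k}" using l by blast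
    qed
  qed
  then show ?thesis by (rule bij_betw_same_card[symmetric])
qed

theorem whitney_duals: "whitney_duals P le z0 Q leQ botQ"
  unfolding whitney_duals_def
proof (intro conjI allI graded_with_bot dual.graded_with_bot)
  fix k
  have "whitney_w P le z0 k = (\<Sum>x | x \<in> P \<and> rk x = k. (-1) ^ rk x * int (card (af_chains x)))"
    using sum_af_chains_eq_0 by (intro whitney_w_eq) (simp_all add: rk_bot af_chains_bot)
  \<comment> \<open>All summands of one rank carry the same sign, so the absolute value is a plain
    count.\<close>
  also have "\<dots> = (-1) ^ k * int (card {X \<in> Q. rkQ X = k})"
    by (simp add: card_rkQ_eq sum_distrib_left)
  finally show "\<bar>whitney_w P le z0 k\<bar> = int (whitney_W Q leQ botQ k)"
    by (simp add: dual.whitney_W_eq abs_mult power_abs)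
  let ?g = "\<lambda>X. if has_increasing X then (-1::int) ^ rkQ X else 0"
  have "whitney_w Q leQ botQ k = (\<Sum>X | X \<in> Q \<and> rkQ X = k. ?g X)"
    using sum_has_increasing_eq_0
    by (intro dual.whitney_w_eq) (simp_all add: dual.rk_bot has_increasing_bot)
  also have "\<dots> = (\<Sum>X | X \<in> Q \<and> rkQ X = k \<and> has_increasing X. (-1) ^ k)"
    using dual.finite_carrier by (intro sum.mono_neutral_cong_right) auto
  also have "\<dots> = (-1) ^ k * int (card {x \<in> P. rk x = k})"
    by (simp add: card_has_increasing_eq)
  finally show "\<bar>whitney_w Q leQ botQ k\<bar> = int (whitney_W P le z0 k)"
    by (simp add: whitney_W_eq abs_mult power_abs)
qed

end

section \<open>Weighted partitions\<close>

text \<open>This is the body of \<open>lamE\<close> as a relation, so a merge and its label can be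
  treated together before the definite description is resolved.\<close>

definition wstep :: "wpart \<Rightarrow> nat \<times> nat \<times> nat \<Rightarrow> wpart \<Rightarrow> bool" where
  "wstep x l y \<longleftrightarrow> (\<exists>A wA B wB u. (A, wA) \<in> x \<and> (B, wB) \<in> x \<and> Min A < Min B \<and> u \<le> 1 \<and>
     y = (x - {(A, wA), (B, wB)}) \<union> {(A \<union> B, wA + wB + u)} \<and> l = (Min A, Min B, u))"

text \<open>Labels see a block only through its minimum. A merge removes one minimum and keeps all
  others.\<close>

definition mins :: "wpart \<Rightarrow> nat set" where
  "mins x = (\<lambda>p. Min (fst p)) ` x"

text \<open>Here and in \<open>wsum\<close>, \<open>C\<close> will be a block of a partition refined
  by \<open>x\<close>; a block of \<open>x\<close> then has its minimum in \<open>C\<close> exactly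
  if it is contained in \<open>C\<close>.\<close>

definition nblocks :: "wpart \<Rightarrow> nat set \<Rightarrow> nat" where
  "nblocks x C = card (mins x \<inter> C)"

definition wsum :: "wpart \<Rightarrow> nat set \<Rightarrow> nat" where
  "wsum x C = sum snd {p \<in> x. Min (fst p) \<in> C}"

lemma WP_block:
  assumes "x \<in> WP n" "(A, w) \<in> x"
  shows "A \<noteq> {}" "finite A" "A \<subseteq> {1..n}" "w < card A" "Min A \<in> A"
proof -
  have "A \<subseteq> \<Union> (fst ` x)" using assms(2) by force
  then show "A \<noteq> {}" "A \<subseteq> {1..n}" "w < card A"
    using assms unfolding WP_def by auto
  then show "finite A" by (metis finite_atLeastAtMost finite_subset)
  then show "Min A \<in> A" using \<open>A \<noteq> {}\<close> by simp
qed

lemma WP_disjoint: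
  assumes "x \<in> WP n" "(A, w) \<in> x" "(B, v) \<in> x" "e \<in> A" "e \<in> B"
  shows "A = B" "w = v"
proof -
  have "(A, w) = (B, v)"
  proof (rule ccontr)
    have "\<forall>p\<in>x. \<forall>q\<in>x. p \<noteq> q \<longrightarrow> fst p \<inter> fst q = {}"
      using assms(1) unfolding WP_def by simp
    moreover assume "(A, w) \<noteq> (B, v)"
    ultimately have "fst (A, w) \<inter> fst (B, v) = {}" using assms(2,3) by blast
    then show False using assms(4,5) by auto
  qed
  then show "A = B" "w = v" by simp_all
qed

lemma WP_Min_inj:
  assumes "x \<in> WP n" "(A, w) \<in> x" "(B, v) \<in> x" "Min A = Min B"
  shows "A = B" "w = v"
  using WP_disjoint[OF assms(1-3), of "Min A"] WP_block(5)[OF assms(1,2)]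
    WP_block(5)[OF assms(1,3)] assms(4) by simp_all

lemma WP_cover:
  assumes "x \<in> WP n" "e \<in> {1..n}"
  obtains A w where "(A, w) \<in> x" "e \<in> A"
proof -
  have "e \<in> \<Union> (fst ` x)" using assms unfolding WP_def by blast
  then show ?thesis using that by force
qed

lemma inj_on_Min_WP: "x \<in> WP n \<Longrightarrow> inj_on (\<lambda>p. Min (fst p)) x"
  using WP_Min_inj by (intro inj_onI) (metis prod.collapse)

lemma finite_WP: "finite (WP n)"
proof (rule finite_subset)
  show "WP n \<subseteq> Pow (Pow {1..n} \<times> {0..n})"
  proof (intro subsetI PowI)
    fix x p assume x: "x \<in> WP n" "p \<in> x"
    obtain A w where p: "p = (A, w)" by (cases p)
    have "A \<subseteq> {1..n}" "w < card A" using WP_block[OF x(1), of A w] x(2) p by auto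
    moreover have "card A \<le> card {1..n}" using calculation by (intro card_mono) auto
    ultimately show "p \<in> Pow {1..n} \<times> {0..n}" using p by auto
  qed
qed simp

lemma mins_subset:
  assumes "x \<in> WP n"
  shows "mins x \<subseteq> {1..n}"
proof
  fix c assume "c \<in> mins x"
  then obtain A w where "(A, w) \<in> x" "c = Min A" unfolding mins_def by force
  then show "c \<in> {1..n}" using WP_block(3,5)[OF assms] by blast
qed

lemma finite_mem_WP:
  assumes "x \<in> WP n"
  shows "finite x"
proof (rule finite_imageD[OF _ inj_on_Min_WP[OF assms]])
  have "(\<lambda>p. Min (fst p)) ` x \<subseteq> {1..n}"
    using mins_subset[OF assms] unfolding mins_def .
  then show "finite ((\<lambda>p. Min (fst p)) ` x)" by (rule finite_subset) simp
qed

lemma finite_mins: "x \<in> WP n \<Longrightarrow> finite (mins x)"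
  using finite_mem_WP unfolding mins_def by blast

lemma card_mins: "x \<in> WP n \<Longrightarrow> card (mins x) = card x"
  unfolding mins_def by (rule card_image[OF inj_on_Min_WP])

lemma card_WP_le: "x \<in> WP n \<Longrightarrow> card x \<le> n"
  using card_mins[of x n] card_mono[OF _ mins_subset[of x n]] by simp

lemma mem_mins: "(A, w) \<in> x \<Longrightarrow> Min A \<in> mins x"
  unfolding mins_def by force

lemma minsE:
  assumes "a \<in> mins x"
  obtains A w where "(A, w) \<in> x" "a = Min A"
  using assms unfolding mins_def by force

section \<open>A single merge and what it changes\<close>

lemma wstepE:
  assumes "x \<in> WP n" "wstep x l y"
  obtains A wA B wB u where "(A, wA) \<in> x" "(B, wB) \<in> x" "Min A < Min B" "u \<le> 1"
    "y = (x - {(A, wA), (B, wB)}) \<union> {(A \<union> B, wA + wB + u)}" "l = (Min A, Min B, u)"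
    "A \<inter> B = {}" "\<forall>w. (A \<union> B, w) \<notin> x" "Min (A \<union> B) = Min A"
proof -
  from assms(2) obtain A wA B wB u where *: "(A, wA) \<in> x" "(B, wB) \<in> x" "Min A < Min B" "u \<le> 1"
    "y = (x - {(A, wA), (B, wB)}) \<union> {(A \<union> B, wA + wB + u)}" "l = (Min A, Min B, u)"
    unfolding wstep_def by blast
  note bA = WP_block[OF assms(1) *(1)] and bB = WP_block[OF assms(1) *(2)]
  have dis: "A \<inter> B = {}"
    using WP_disjoint(1)[OF assms(1) *(1,2)] *(3) by blast
  have "\<forall>w. (A \<union> B, w) \<notin> x"
    using WP_disjoint(1)[OF assms(1) *(1), of "A \<union> B" _ "Min A"] bA(5) bB(1) dis by blast
  moreover have "Min (A \<union> B) = Min A"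
    using Min_Un[OF bA(2,1) bB(2,1)] *(3) by simp
  ultimately show ?thesis using that[OF * dis] by blast
qed

lemma wstep_WP:
  assumes x: "x \<in> WP n" and "wstep x l y"
  shows "y \<in> WP n"
proof -
  obtain A wA B wB u where *: "(A, wA) \<in> x" "(B, wB) \<in> x" "u \<le> 1"
    "y = (x - {(A, wA), (B, wB)}) \<union> {(A \<union> B, wA + wB + u)}" "A \<inter> B = {}"
    by (rule wstepE[OF assms])
  note bA = WP_block[OF x *(1)] and bB = WP_block[OF x *(2)]
  have y_cases: "p = (A \<union> B, wA + wB + u) \<or> p \<in> x \<and> fst p \<inter> (A \<union> B) = {}" if p: "p \<in> y" for p
  proof (cases "p = (A \<union> B, wA + wB + u)")
    case False
    then have px: "p \<in> x" "p \<noteq> (A, wA)" "p \<noteq> (B, wB)" using p *(4) by auto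
    obtain C w where C: "p = (C, w)" by (cases p)
    have Cx: "(C, w) \<in> x" using px(1) C by simp
    have "C \<inter> A = {}"
      using WP_disjoint[OF x Cx *(1)] px(2) C by blast
    moreover have "C \<inter> B = {}"
      using WP_disjoint[OF x Cx *(2)] px(3) C by blast
    ultimately show ?thesis using px C by auto
  qed simp
  have "\<forall>(C, v)\<in>y. C \<noteq> {} \<and> v < card C"
  proof clarify
    fix C v assume C: "(C, v) \<in> y"
    \<comment> \<open>The weights are at most |A| - 1 and |B| - 1, so the merged block has room for
      an increment of 1.\<close>
    have "wA + wB + u < card (A \<union> B)"
      using bA(2,4) bB(2,4) *(3,5) by (simp add: card_Un_disjoint)
    then show "C \<noteq> {} \<and> v < card C"
      using y_cases[OF C] bA(1) WP_block(1,4)[OF x, of C v] by auto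
  qed
  moreover have "\<Union> (fst ` y) = {1..n}"
  proof -
    have "\<Union> (fst ` y) = \<Union> (fst ` x)"
    proof (intro equalityI subsetI)
      fix e assume "e \<in> \<Union> (fst ` x)"
      then obtain C w where C: "(C, w) \<in> x" "e \<in> C" by force
      then have "(C, w) \<in> y \<or> C = A \<or> C = B" unfolding *(4) by auto
      moreover have "(A \<union> B, wA + wB + u) \<in> y" unfolding *(4) by simp
      ultimately show "e \<in> \<Union> (fst ` y)" using C(2) by (metis UN_I Un_iff fst_conv)
    next
      fix e assume "e \<in> \<Union> (fst ` y)"
      then obtain C w where C: "(C, w) \<in> y" "e \<in> C" by force
      then have "e \<in> A \<or> e \<in> B \<or> (C, w) \<in> x" unfolding *(4) by auto
      then show "e \<in> \<Union> (fst ` x)" using C(2) *(1,2) by (metis UN_I fst_conv)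
    qed
    then show ?thesis using x unfolding WP_def by simp
  qed
  moreover have "\<forall>p\<in>y. \<forall>q\<in>y. p \<noteq> q \<longrightarrow> fst p \<inter> fst q = {}"
  proof (intro ballI impI)
    fix p q assume "p \<in> y" "q \<in> y" "p \<noteq> q"
    moreover have "p \<in> x \<Longrightarrow> q \<in> x \<Longrightarrow> p \<noteq> q \<Longrightarrow> fst p \<inter> fst q = {}"
      using x unfolding WP_def by blast
    ultimately show "fst p \<inter> fst q = {}"
      using y_cases[of p] y_cases[of q] by auto
  qed
  ultimately show ?thesis unfolding WP_def by blast
qed

text \<open>The union is not a block of \<open>x\<close>, so \<open>x - y\<close> consists of the
  two merged blocks and \<open>y - x\<close> of the new one; the label can be read off from these
  differences.\<close>

lemma wstep_label_unique:
  assumes x: "x \<in> WP n" and s: "wstep x l y" "wstep x l' y"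
  shows "l = l'"
proof -
  obtain A wA B wB u where *: "(A, wA) \<in> x" "(B, wB) \<in> x" "Min A < Min B"
    "y = (x - {(A, wA), (B, wB)}) \<union> {(A \<union> B, wA + wB + u)}" "l = (Min A, Min B, u)"
    "\<forall>w. (A \<union> B, w) \<notin> x"
    by (rule wstepE[OF x s(1)])
  obtain C wC D wD v where **: "(C, wC) \<in> x" "(D, wD) \<in> x" "Min C < Min D"
    "y = (x - {(C, wC), (D, wD)}) \<union> {(C \<union> D, wC + wD + v)}" "l' = (Min C, Min D, v)"
    "\<forall>w. (C \<union> D, w) \<notin> x"
    by (rule wstepE[OF x s(2)])
  have 1: "x - y = {(A, wA), (B, wB)}" "y - x = {(A \<union> B, wA + wB + u)}"
    using *(1,2,6) unfolding *(4) by auto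
  have 2: "x - y = {(C, wC), (D, wD)}" "y - x = {(C \<union> D, wC + wD + v)}"
    using **(1,2,6) unfolding **(4) by auto
  have "{(A, wA), (B, wB)} = {(C, wC), (D, wD)}"
    by (rule trans[OF 1(1)[symmetric] 2(1)])
  moreover have "{(A \<union> B, wA + wB + u)} = {(C \<union> D, wC + wD + v)}"
    by (rule trans[OF 1(2)[symmetric] 2(2)])
  ultimately show ?thesis
    using *(3,5) **(3,5) by (auto simp: doubleton_eq_iff)
qed

text \<open>The minima in the label identify both blocks together with their weights. Injectivity of
  label words and uniqueness in the switching property come from this.\<close>

lemma wstep_target_unique:
  assumes x: "x \<in> WP n" and s: "wstep x l y" "wstep x l y'"
  shows "y = y'"
proof -
  obtain A wA B wB u where *: "(A, wA) \<in> x" "(B, wB) \<in> x"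
    "y = (x - {(A, wA), (B, wB)}) \<union> {(A \<union> B, wA + wB + u)}" "l = (Min A, Min B, u)"
    by (rule wstepE[OF x s(1)])
  obtain C wC D wD v where **: "(C, wC) \<in> x" "(D, wD) \<in> x"
    "y' = (x - {(C, wC), (D, wD)}) \<union> {(C \<union> D, wC + wD + v)}" "l = (Min C, Min D, v)"
    by (rule wstepE[OF x s(2)])
  have l: "Min A = Min C" "Min B = Min D" "u = v"
    using *(4) **(4) by simp_all
  have "A = C" "wA = wC" "B = D" "wB = wD"
    using WP_Min_inj[OF x *(1) **(1) l(1)] WP_Min_inj[OF x *(2) **(2) l(2)] by blast+
  then show ?thesis using *(3) **(3) l(3) by metis
qed

lemma lamE_eq:
  assumes "x \<in> WP n" "wstep x l y"
  shows "lamE x y = l"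
proof -
  have "lamE x y = (THE l. wstep x l y)"
    unfolding lamE_def wstep_def ..
  also have "\<dots> = l"
    using assms(2) wstep_label_unique[OF assms(1) _ assms(2)] by (rule the_equality)
  finally show ?thesis .
qed

lemma wcov_iff: "wcov n x y \<longleftrightarrow> x \<in> WP n \<and> (\<exists>l. wstep x l y)"
proof
  assume "wcov n x y"
  then obtain A wA B wB u where x: "x \<in> WP n" and *: "(A, wA) \<in> x" "(B, wB) \<in> x" "A \<noteq> B" "u \<le> 1"
    "y = (x - {(A, wA), (B, wB)}) \<union> {(A \<union> B, wA + wB + u)}"
    unfolding wcov_def by blast
  have "Min A \<noteq> Min B" using WP_Min_inj(1)[OF x *(1,2)] *(3) by blast
  then consider "Min A < Min B" | "Min B < Min A" by linarith
  then have "\<exists>l. wstep x l y"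
  proof cases
    case 1
    then have "wstep x (Min A, Min B, u) y" unfolding wstep_def using * by blast
    then show ?thesis ..
  next
    case 2
    have "y = (x - {(B, wB), (A, wA)}) \<union> {(B \<union> A, wB + wA + u)}"
      using *(5) by (simp add: insert_commute Un_commute add.commute)
    then have "wstep x (Min B, Min A, u) y" unfolding wstep_def using * 2 by blast
    then show ?thesis ..
  qed
  then show "x \<in> WP n \<and> (\<exists>l. wstep x l y)" using x by blast
next
  assume "x \<in> WP n \<and> (\<exists>l. wstep x l y)"
  then obtain l where x: "x \<in> WP n" "wstep x l y" by blast
  obtain A wA B wB u where *: "(A, wA) \<in> x" "(B, wB) \<in> x" "Min A < Min B" "u \<le> 1"
    "y = (x - {(A, wA), (B, wB)}) \<union> {(A \<union> B, wA + wB + u)}"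
    by (rule wstepE[OF x])
  moreover have "A \<noteq> B" using *(3) by blast
  ultimately show "wcov n x y" unfolding wcov_def using x(1) wstep_WP[OF x] by metis
qed

lemma wstep_mins:
  assumes x: "x \<in> WP n" and s: "wstep x (a, b, u) y"
  shows "a \<in> mins x" "b \<in> mins x" "a < b" "u \<le> 1" "mins y = mins x - {b}"
    "\<exists>A B w. (A \<union> B, w) \<in> y \<and> a \<in> A \<and> b \<in> B \<and> (\<forall>(C, v)\<in>x. C = A \<or> C = B \<or> (C, v) \<in> y)"
proof -
  obtain A wA B wB u' where *: "(A, wA) \<in> x" "(B, wB) \<in> x" "Min A < Min B" "u' \<le> 1"
    "y = (x - {(A, wA), (B, wB)}) \<union> {(A \<union> B, wA + wB + u')}" "(a, b, u) = (Min A, Min B, u')"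
    "A \<inter> B = {}" "\<forall>w. (A \<union> B, w) \<notin> x" "Min (A \<union> B) = Min A"
    by (rule wstepE[OF x s])
  then have eq: "a = Min A" "b = Min B" "u = u'" by auto
  show "a \<in> mins x" "b \<in> mins x" using *(1,2) mem_mins eq by auto
  show "a < b" "u \<le> 1" using eq * by auto
  show "mins y = mins x - {b}"
  proof (intro equalityI subsetI)
    fix c assume "c \<in> mins y"
    then obtain C w where C: "(C, w) \<in> y" "c = Min C" by (rule minsE)
    then consider "c = a" | "(C, w) \<in> x" "(C, w) \<noteq> (B, wB)" using *(5,9) eq by auto
    then show "c \<in> mins x - {b}"
    proof cases
      case 1
      then show ?thesis using \<open>a \<in> mins x\<close> \<open>a < b\<close> by simp
    next
      case 2
      then show ?thesis using WP_Min_inj[OF x 2(1) *(2)] C(2) eq mem_mins by auto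
    qed
  next
    fix c assume c: "c \<in> mins x - {b}"
    then obtain C w where C: "(C, w) \<in> x" "c = Min C" using minsE by blast
    show "c \<in> mins y"
    proof (cases "(C, w) = (A, wA)")
      case True
      then have "c = Min (A \<union> B)" using C(2) *(9) by simp
      then show ?thesis using mem_mins[of "A \<union> B" _ y] *(5) by blast
    next
      case False
      then have "(C, w) \<in> y" using C c eq *(5) by auto
      then show ?thesis using C(2) mem_mins by blast
    qed
  qed
  have "\<forall>(C, v)\<in>x. C = A \<or> C = B \<or> (C, v) \<in> y" using *(5) by auto
  moreover have "(A \<union> B, wA + wB + u') \<in> y" using *(5) by blast
  moreover have "a \<in> A" "b \<in> B" using eq WP_block(5)[OF x] * by auto
  ultimately show "\<exists>A B w. (A \<union> B, w) \<in> y \<and> a \<in> A \<and> b \<in> B \<and>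
      (\<forall>(C, v)\<in>x. C = A \<or> C = B \<or> (C, v) \<in> y)" by blast
qed

lemma wstep_card:
  assumes x: "x \<in> WP n" and s: "wstep x l y"
  shows "card x = Suc (card y)"
proof -
  obtain a b u where l: "l = (a, b, u)" by (cases l)
  note m = wstep_mins[OF x s[unfolded l]]
  have "card (mins x) = Suc (card (mins y))"
    unfolding m(5) by (rule card.remove[OF finite_mins[OF x] m(2)])
  then show ?thesis using card_mins[OF x] card_mins[OF wstep_WP[OF x s]] by simp
qed

lemma wstep_nblocks:
  assumes x: "x \<in> WP n" and s: "wstep x (a, b, u) y"
  shows "nblocks x C = nblocks y C + (if b \<in> C then 1 else 0)"
proof (cases "b \<in> C")
  case True
  then have "mins y \<inter> C = mins x \<inter> C - {b}" "b \<in> mins x \<inter> C"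
    using wstep_mins[OF x s] by auto
  then show ?thesis
    unfolding nblocks_def using True finite_mins[OF x] card.remove[of "mins x \<inter> C" b] by simp
next
  case False
  then have "mins y \<inter> C = mins x \<inter> C" using wstep_mins(5)[OF x s] by auto
  then show ?thesis unfolding nblocks_def using False by simp
qed

text \<open>The merged block has minimum \<open>a\<close>, so the weight of the block with minimum
  \<open>b\<close> moves to the side of \<open>a\<close>. When \<open>a\<close> and \<open>b\<close>
  are on the same side of \<open>C\<close>, only the increment can change the sum.\<close>

lemma wstep_wsum:
  assumes x: "x \<in> WP n" and s: "wstep x (a, b, u) y" and ab: "a \<in> C \<longleftrightarrow> b \<in> C"
  shows "wsum y C = wsum x C + (if b \<in> C then u else 0)"
proof -
  obtain A wA B wB u' where *: "(A, wA) \<in> x" "(B, wB) \<in> x" "Min A < Min B" "u' \<le> 1"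
    "y = (x - {(A, wA), (B, wB)}) \<union> {(A \<union> B, wA + wB + u')}" "(a, b, u) = (Min A, Min B, u')"
    "A \<inter> B = {}" "\<forall>w. (A \<union> B, w) \<notin> x" "Min (A \<union> B) = Min A"
    by (rule wstepE[OF x s])
  then have eq: "a = Min A" "b = Min B" "u = u'" by auto
  have ne: "(A, wA) \<noteq> (B, wB)" using *(3) by auto
  define R where "R = {p \<in> x - {(A, wA), (B, wB)}. Min (fst p) \<in> C}"
  have fin: "finite R" unfolding R_def using finite_mem_WP[OF x] by simp
  show ?thesis
  proof (cases "b \<in> C")
    case True
    have "{p \<in> x. Min (fst p) \<in> C} = insert (A, wA) (insert (B, wB) R)"
      "{p \<in> y. Min (fst p) \<in> C} = insert (A \<union> B, wA + wB + u') R"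
      using True ab eq * unfolding R_def by auto
    moreover have "(A, wA) \<notin> insert (B, wB) R" "(B, wB) \<notin> R" "(A \<union> B, wA + wB + u') \<notin> R"
      using ne *(8) unfolding R_def by auto
    ultimately show ?thesis
      unfolding wsum_def using fin True eq by simp
  next
    case False
    have "{p \<in> x. Min (fst p) \<in> C} = R" "{p \<in> y. Min (fst p) \<in> C} = R"
      using False ab eq * unfolding R_def by auto
    then show ?thesis unfolding wsum_def using False by simp
  qed
qed

text \<open>The second merge either involves two blocks of \<open>x\<close> untouched by the first one, or adds a
  third block to the block with minimum \<open>a\<close>.\<close>

lemma wstep_switch:
  assumes x: "x \<in> WP n" and s: "wstep x (a, b, u) x1" "wstep x1 (c, d, v) x2" and "a \<le> c"
  shows "\<exists>x'. wstep x (c, d, v) x' \<and> wstep x' (a, b, u) x2"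
proof -
  obtain A wA B wB u' where *: "(A, wA) \<in> x" "(B, wB) \<in> x" "Min A < Min B" "u' \<le> 1"
    "x1 = (x - {(A, wA), (B, wB)}) \<union> {(A \<union> B, wA + wB + u')}" "(a, b, u) = (Min A, Min B, u')"
    "A \<inter> B = {}" "\<forall>w. (A \<union> B, w) \<notin> x" "Min (A \<union> B) = Min A"
    by (rule wstepE[OF x s(1)])
  have x1: "x1 \<in> WP n" using wstep_WP[OF x s(1)] .
  obtain C wC D wD v' where **: "(C, wC) \<in> x1" "(D, wD) \<in> x1" "Min C < Min D" "v' \<le> 1"
    "x2 = (x1 - {(C, wC), (D, wD)}) \<union> {(C \<union> D, wC + wD + v')}" "(c, d, v) = (Min C, Min D, v')"
    "C \<inter> D = {}" "\<forall>w. (C \<union> D, w) \<notin> x1" "Min (C \<union> D) = Min C"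
    by (rule wstepE[OF x1 s(2)])
  have eq: "a = Min A" "b = Min B" "u = u'" "c = Min C" "d = Min D" "v = v'"
    using *(6) **(6) by auto
  let ?r = "(A \<union> B, wA + wB + u')"
  \<comment> \<open>The first merge produces a block with minimum \<open>a \<le> c < d\<close>, so
    the second can use it only as its first block: \<open>D\<close> is an old block.\<close>
  have D: "(D, wD) \<in> x" "(D, wD) \<noteq> (A, wA)" "(D, wD) \<noteq> (B, wB)" "(D, wD) \<noteq> ?r"
    using **(2,3) *(5,9) \<open>a \<le> c\<close> eq by auto
  note bA = WP_block[OF x *(1)] and bB = WP_block[OF x *(2)] and bD = WP_block[OF x D(1)]
  have disD: "A \<inter> D = {}" "B \<inter> D = {}"
    using WP_disjoint[OF x *(1) D(1)] WP_disjoint[OF x *(2) D(1)] D(2,3) by blast+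
  show ?thesis
  proof (cases "(C, wC) = ?r")
    case True
    then have ca: "Min C = Min A" using *(9) by simp
    let ?s = "(A \<union> D, wA + wD + v')"
    let ?x' = "(x - {(A, wA), (D, wD)}) \<union> {?s}"
    have "wstep x (c, d, v) ?x'"
      unfolding wstep_def using *(1) D(1) **(3,4) ca eq by metis
    moreover have "wstep ?x' (a, b, u) x2"
      unfolding wstep_def
    proof (intro exI conjI)
      show "?s \<in> ?x'" by simp
      show "(B, wB) \<in> ?x'" using *(2,3) D(3) by auto
      have m: "Min (A \<union> D) = Min A"
        using Min_Un[OF bA(2,1) bD(2,1)] **(3) ca by simp
      then show "Min (A \<union> D) < Min B" "(a, b, u) = (Min (A \<union> D), Min B, u')"
        using *(3) eq by auto
      have "?s \<notin> x"
        using WP_disjoint(1)[OF x *(1), of "A \<union> D" _ "Min A"] bA(5) bD(1) disD by blast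
      moreover have "x2 = (x - {(A, wA), (B, wB), (D, wD)}) \<union> {(A \<union> B \<union> D, wA + wB + u' + wD + v')}"
        unfolding **(5) *(5) using True *(8) D(4) by auto
      ultimately show "x2 = (?x' - {?s, (B, wB)}) \<union> {(A \<union> D \<union> B, wA + wD + v' + wB + u')}"
        by (auto simp: Un_ac add_ac)
    qed (rule *(4))
    ultimately show ?thesis by blast
  next
    case False
    then have C: "(C, wC) \<in> x" "(C, wC) \<noteq> (A, wA)" "(C, wC) \<noteq> (B, wB)"
      using **(1) *(5) by auto
    let ?s = "(C \<union> D, wC + wD + v')"
    let ?x' = "(x - {(C, wC), (D, wD)}) \<union> {?s}"
    have "wstep x (c, d, v) ?x'"
      unfolding wstep_def using C(1) D(1) **(3,4) eq by metis
    moreover have "wstep ?x' (a, b, u) x2"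
      unfolding wstep_def
    proof (intro exI conjI)
      show "(A, wA) \<in> ?x'" using *(1) D(2) C(2) by auto
      show "(B, wB) \<in> ?x'" using *(2) D(3) C(3) by auto
      have "C \<noteq> C \<union> D" using bD(1) **(7) by blast
      then have "?s \<notin> x"
        using WP_disjoint(1)[OF x C(1), of "C \<union> D" _ "Min C"] WP_block(5)[OF x C(1)] by blast
      then show "x2 = (?x' - {(A, wA), (B, wB)}) \<union> {?r}"
        unfolding **(5) *(5) using False D(4) *(1,2) by auto
    qed (use *(3,4) eq in auto)
    ultimately show ?thesis by blast
  qed
qed

section \<open>Intervals of weighted partitions\<close>

definition refines :: "wpart \<Rightarrow> wpart \<Rightarrow> bool" where
  "refines x y \<longleftrightarrow> (\<forall>(A, w)\<in>x. \<exists>(B, v)\<in>y. A \<subseteq> B)"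

text \<open>The order of weighted partitions without reference to chains: a block of \<open>y\<close> is merged
  from \<open>t\<close> blocks of \<open>x\<close> by \<open>t - 1\<close> merges, each of which adds 0 or 1 to the weight.\<close>

definition wbelow :: "wpart \<Rightarrow> wpart \<Rightarrow> bool" where
  "wbelow x y \<longleftrightarrow> refines x y \<and>
     (\<forall>(B, v)\<in>y. wsum x B \<le> v \<and> v + 1 \<le> wsum x B + nblocks x B)"

lemma refinesD:
  assumes y: "y \<in> WP n" and "refines x y" "(A, w) \<in> x" "(B, v) \<in> y" "e \<in> A" "e \<in> B"
  shows "A \<subseteq> B"
proof -
  obtain B' v' where B': "(B', v') \<in> y" "A \<subseteq> B'"
    using assms(2,3) unfolding refines_def by blast
  then have "B' = B" using WP_disjoint(1)[OF y B'(1) assms(4), of e] assms(5,6) by blast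
  then show ?thesis using B'(2) by simp
qed

lemma refines_block_of:
  assumes x: "x \<in> WP n" and y: "y \<in> WP n" and r: "refines x y" and B: "(B, v) \<in> y" and "e \<in> B"
  obtains A w where "(A, w) \<in> x" "e \<in> A" "A \<subseteq> B"
proof -
  have "e \<in> {1..n}" using WP_block(3)[OF y B] \<open>e \<in> B\<close> by blast
  then obtain A w where A: "(A, w) \<in> x" "e \<in> A" by (rule WP_cover[OF x])
  then show ?thesis using that refinesD[OF y r A(1) B A(2) \<open>e \<in> B\<close>] by blast
qed

text \<open>The block of \<open>x\<close> containing \<open>Min B\<close> lies inside
  \<open>B\<close>, so it has the same minimum.\<close>

lemma Min_in_mins:
  assumes x: "x \<in> WP n" and y: "y \<in> WP n" and r: "refines x y" and B: "(B, v) \<in> y"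
  shows "Min B \<in> mins x \<inter> B"
proof -
  note b = WP_block[OF y B]
  obtain A w where A: "(A, w) \<in> x" "Min B \<in> A" "A \<subseteq> B"
    by (rule refines_block_of[OF x y r B b(5)])
  have "Min A \<in> B" "Min A \<le> Min B"
    using A WP_block(2,5)[OF x A(1)] by auto
  then have "Min A = Min B" using b(2) by (simp add: order_antisym)
  then show ?thesis using mem_mins[OF A(1)] b(5) by simp
qed

lemma nblocks_eq_1_iff:
  assumes x: "x \<in> WP n" and y: "y \<in> WP n" and r: "refines x y" and B: "(B, v) \<in> y"
  shows "nblocks x B = 1 \<longleftrightarrow> mins x \<inter> B = {Min B}"
proof
  assume "nblocks x B = 1"
  then obtain c where "mins x \<inter> B = {c}" unfolding nblocks_def by (auto simp: card_1_singleton_iff)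
  then show "mins x \<inter> B = {Min B}" using Min_in_mins[OF assms] by simp
qed (simp add: nblocks_def)

lemma wbelow_refl:
  assumes x: "x \<in> WP n"
  shows "wbelow x x"
  unfolding wbelow_def
proof (intro conjI ballI)
  show "refines x x" unfolding refines_def by blast
  fix p assume p: "p \<in> x"
  obtain B v where B: "p = (B, v)" by (cases p)
  have "q = p" if q: "q \<in> x" "Min (fst q) \<in> B" for q
  proof -
    obtain A w where A: "q = (A, w)" by (cases q)
    have "Min A \<in> A" using WP_block(5)[OF x, of A w] q A by simp
    then show ?thesis
      using WP_disjoint[OF x, of A w B v "Min A"] p q A B by simp
  qed
  moreover have "Min (fst p) \<in> B" using WP_block(5)[OF x, of B v] p B by simp
  ultimately have 1: "{q \<in> x. Min (fst q) \<in> B} = {p}" using p by blast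
  have "mins x \<inter> B = (\<lambda>q. Min (fst q)) ` {q \<in> x. Min (fst q) \<in> B}"
    unfolding mins_def by blast
  then have "nblocks x B = 1" unfolding nblocks_def 1 by simp
  moreover have "wsum x B = v" unfolding wsum_def 1 using B by simp
  ultimately have "wsum x B \<le> v \<and> v + 1 \<le> wsum x B + nblocks x B" by simp
  then show "case p of (B, v) \<Rightarrow> wsum x B \<le> v \<and> v + 1 \<le> wsum x B + nblocks x B"
    using B by simp
qed

text \<open>For a single part the bounds S <= v <= S + t - 1 with t = 1 force v = S, so the weights
  agree as well as the blocks.\<close>

lemma wbelow_all_trivial:
  assumes x: "x \<in> WP n" and y: "y \<in> WP n" and xy: "wbelow x y"
    and triv: "\<And>B v. (B, v) \<in> y \<Longrightarrow> nblocks x B = 1"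
  shows "x = y"
proof -
  have r: "refines x y" using xy unfolding wbelow_def by blast
  have eq: "A = B \<and> w = v" if B: "(B, v) \<in> y" and A: "(A, w) \<in> x" "A \<subseteq> B" for A w B v
  proof -
    have m: "mins x \<inter> B = {Min B}"
      using nblocks_eq_1_iff[OF x y r B] triv[OF B] by blast
    have unique: "(A', w') = (A, w)" if A': "(A', w') \<in> x" "Min A' \<in> B" for A' w'
    proof -
      have "Min A' \<in> mins x \<inter> B" using mem_mins[OF A'(1)] A'(2) by blast
      moreover have "Min A \<in> mins x \<inter> B"
        using mem_mins[OF A(1)] WP_block(5)[OF x A(1)] A(2) by blast
      ultimately have "Min A' = Min A" using m by simp
      then show ?thesis using WP_Min_inj[OF x A'(1) A(1)] by simp
    qed
    have "B \<subseteq> A"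
    proof
      fix e assume e: "e \<in> B"
      obtain A' w' where A': "(A', w') \<in> x" "e \<in> A'" "A' \<subseteq> B"
        by (rule refines_block_of[OF x y r B e])
      then have "A' = A" using unique[OF A'(1)] WP_block(5)[OF x A'(1)] by blast
      then show "e \<in> A" using A'(2) by simp
    qed
    moreover have "{q \<in> x. Min (fst q) \<in> B} = {(A, w)}"
    proof (intro equalityI subsetI)
      fix q assume "q \<in> {q \<in> x. Min (fst q) \<in> B}"
      then show "q \<in> {(A, w)}" using unique[of "fst q" "snd q"] by simp
    next
      fix q assume "q \<in> {(A, w)}"
      then show "q \<in> {q \<in> x. Min (fst q) \<in> B}" using A WP_block(5)[OF x A(1)] by auto
    qed
    then have "wsum x B = w" unfolding wsum_def by simp
    moreover have "wsum x B \<le> v \<and> v + 1 \<le> wsum x B + nblocks x B"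
      using xy B unfolding wbelow_def by blast
    ultimately show ?thesis using A(2) triv[OF B] by auto
  qed
  show ?thesis
  proof (intro equalityI subsetI)
    fix p assume p: "p \<in> x"
    obtain A w where A: "p = (A, w)" by (cases p)
    obtain B v where B: "(B, v) \<in> y" "A \<subseteq> B"
      using r p A unfolding refines_def by blast
    then show "p \<in> y" using eq[OF B(1) _ B(2)] p A by blast
  next
    fix p assume p: "p \<in> y"
    obtain B v where B: "p = (B, v)" by (cases p)
    have By: "(B, v) \<in> y" using p B by simp
    obtain A w where A: "(A, w) \<in> x" "Min B \<in> A" "A \<subseteq> B"
      by (rule refines_block_of[OF x y r By WP_block(5)[OF y By]])
    then show "p \<in> x" using eq[OF By A(1,3)] B by blast
  qed
qed

lemma wstep_refines:
  assumes x: "x \<in> WP n" and s: "wstep x (a, b, u) x1" and y: "y \<in> WP n"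
  shows "refines x1 y \<longleftrightarrow> refines x y \<and> (\<exists>B v. (B, v) \<in> y \<and> a \<in> B \<and> b \<in> B)"
proof -
  obtain A wA B wB u' where *: "(A, wA) \<in> x" "(B, wB) \<in> x" "Min A < Min B" "u' \<le> 1"
    "x1 = (x - {(A, wA), (B, wB)}) \<union> {(A \<union> B, wA + wB + u')}" "(a, b, u) = (Min A, Min B, u')"
    by (rule wstepE[OF x s])
  then have ab: "a \<in> A" "b \<in> B" using WP_block(5)[OF x *(1)] WP_block(5)[OF x *(2)] by auto
  show ?thesis
  proof
    assume r: "refines x1 y"
    have "(A \<union> B, wA + wB + u') \<in> x1" using *(5) by simp
    then obtain C v where C: "(C, v) \<in> y" "A \<union> B \<subseteq> C"
      using r unfolding refines_def by blast
    have "refines x y"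
      unfolding refines_def
    proof (rule ballI)
      fix p assume p: "p \<in> x"
      show "case p of (A, w) \<Rightarrow> \<exists>(B, v)\<in>y. A \<subseteq> B"
      proof (cases "p = (A, wA) \<or> p = (B, wB)")
        case True
        then show ?thesis using C by auto
      next
        case False
        then have "p \<in> x1" using *(5) p by simp
        then show ?thesis using r unfolding refines_def by blast
      qed
    qed
    then show "refines x y \<and> (\<exists>B v. (B, v) \<in> y \<and> a \<in> B \<and> b \<in> B)" using C ab by blast
  next
    assume "refines x y \<and> (\<exists>B v. (B, v) \<in> y \<and> a \<in> B \<and> b \<in> B)"
    then obtain C v where r: "refines x y" and C: "(C, v) \<in> y" "a \<in> C" "b \<in> C" by blast
    have "A \<subseteq> C" "B \<subseteq> C"
      using refinesD[OF y r *(1) C(1) ab(1) C(2)] refinesD[OF y r *(2) C(1) ab(2) C(3)] by auto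
    show "refines x1 y"
      unfolding refines_def
    proof (rule ballI)
      fix p assume p: "p \<in> x1"
      show "case p of (A, w) \<Rightarrow> \<exists>(B, v)\<in>y. A \<subseteq> B"
      proof (cases "p \<in> x")
        case True
        then show ?thesis using r unfolding refines_def by blast
      next
        case False
        then have "p = (A \<union> B, wA + wB + u')" using p *(5) by simp
        then show ?thesis using C(1) \<open>A \<subseteq> C\<close> \<open>B \<subseteq> C\<close> by auto
      qed
    qed
  qed
qed

text \<open>Both merged blocks must lie in one block of \<open>y\<close>, so the conditions of
  \<open>wbelow\<close> change in that block alone.\<close>

lemma wstep_block_counts:
  assumes x: "x \<in> WP n" and s: "wstep x (a, b, u) x1" and y: "y \<in> WP n" and r: "refines x1 y"
  obtains B v where "(B, v) \<in> y" "a \<in> B" "b \<in> B"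
    "nblocks x B = nblocks x1 B + 1" "wsum x1 B = wsum x B + u"
    "\<forall>D w. (D, w) \<in> y \<longrightarrow> D \<noteq> B \<longrightarrow>
       a \<notin> D \<and> b \<notin> D \<and> nblocks x D = nblocks x1 D \<and> wsum x1 D = wsum x D"
proof -
  obtain B v where B: "(B, v) \<in> y" "a \<in> B" "b \<in> B"
    using wstep_refines[OF x s y] r by blast
  have other: "a \<notin> D \<and> b \<notin> D" if D: "(D, w) \<in> y" "D \<noteq> B" for D w
    using WP_disjoint(1)[OF y D(1) B(1)] D(2) B(2,3) by blast
  show ?thesis
  proof (rule that[OF B])
    show "nblocks x B = nblocks x1 B + 1" "wsum x1 B = wsum x B + u"
      using wstep_nblocks[OF x s, of B] wstep_wsum[OF x s, of B] B by simp_all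
    show "\<forall>D w. (D, w) \<in> y \<longrightarrow> D \<noteq> B \<longrightarrow>
        a \<notin> D \<and> b \<notin> D \<and> nblocks x D = nblocks x1 D \<and> wsum x1 D = wsum x D"
      using wstep_nblocks[OF x s] wstep_wsum[OF x s] other by auto
  qed
qed

text \<open>In the affected block a merge raises the lower bound S by \<open>u\<close> and lowers
  the upper bound S + t - 1 by 1 - \<open>u\<close>, so the weights admissible for \<open>x1\<close>
  are admissible for \<open>x\<close>.\<close>

lemma wstep_wbelow:
  assumes x: "x \<in> WP n" and s: "wstep x (a, b, u) x1" and y: "y \<in> WP n" and below: "wbelow x1 y"
  shows "wbelow x y"
proof -
  have r: "refines x1 y" using below unfolding wbelow_def by blast
  obtain B v where B: "(B, v) \<in> y"
    "nblocks x B = nblocks x1 B + 1" "wsum x1 B = wsum x B + u"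
    "\<forall>D w. (D, w) \<in> y \<longrightarrow> D \<noteq> B \<longrightarrow>
       a \<notin> D \<and> b \<notin> D \<and> nblocks x D = nblocks x1 D \<and> wsum x1 D = wsum x D"
    by (rule wstep_block_counts[OF x s y r])
  have "u \<le> 1" using wstep_mins(4)[OF x s] .
  have "wsum x D \<le> w \<and> w + 1 \<le> wsum x D + nblocks x D" if D: "(D, w) \<in> y" for D w
  proof -
    have d: "wsum x1 D \<le> w \<and> w + 1 \<le> wsum x1 D + nblocks x1 D"
      using below D unfolding wbelow_def by blast
    show ?thesis
    proof (cases "D = B")
      case True
      then show ?thesis using d B(2,3) \<open>u \<le> 1\<close> by simp
    next
      case False
      then show ?thesis using d B(4)[rule_format, OF D] by simp
    qed
  qed
  moreover have "refines x y" using wstep_refines[OF x s y] r by blast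
  ultimately show ?thesis unfolding wbelow_def by blast
qed

text \<open>The first label of the increasing chain from \<open>x\<close> to \<open>y\<close>: in the first block of \<open>y\<close> that is
  not a block of \<open>x\<close>, merge the first two blocks of \<open>x\<close>, adding 1 only if all the
  remaining merges in this block have to add 1.\<close>

definition greedy :: "wpart \<Rightarrow> wpart \<Rightarrow> nat \<times> nat \<times> nat \<Rightarrow> bool" where
  "greedy x y = (\<lambda>(a, b, u). \<exists>B v. (B, v) \<in> y \<and> a = Min B \<and> b \<in> mins x \<inter> B \<and> a < b \<and>
     (\<forall>c\<in>mins x \<inter> B. c = a \<or> b \<le> c) \<and> u \<le> 1 \<and>
     (u = 1 \<longleftrightarrow> v + 1 = wsum x B + nblocks x B) \<and>
     (\<forall>(D, w)\<in>y. Min D < a \<longrightarrow> nblocks x D = 1))"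

lemma greedyI:
  assumes "(B, v) \<in> y" "a = Min B" "b \<in> mins x \<inter> B" "a < b"
    "\<And>c. c \<in> mins x \<inter> B \<Longrightarrow> c = a \<or> b \<le> c" "u \<le> 1"
    "u = 1 \<longleftrightarrow> v + 1 = wsum x B + nblocks x B"
    "\<And>D w. (D, w) \<in> y \<Longrightarrow> Min D < a \<Longrightarrow> nblocks x D = 1"
  shows "greedy x y (a, b, u)"
  unfolding greedy_def prod.case by (intro exI[of _ B] exI[of _ v]) (use assms in auto)

lemma greedyE:
  assumes x: "x \<in> WP n" and y: "y \<in> WP n" and r: "refines x y" and "greedy x y (a, b, u)"
  obtains B v where "(B, v) \<in> y" "a = Min B" "b \<in> mins x \<inter> B" "a < b"
    "\<forall>c. c \<in> mins x \<inter> B \<longrightarrow> c \<noteq> a \<longrightarrow> b \<le> c" "u \<le> 1"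
    "u = 1 \<longleftrightarrow> v + 1 = wsum x B + nblocks x B"
    "\<forall>D w. (D, w) \<in> y \<longrightarrow> Min D < a \<longrightarrow> nblocks x D = 1"
    "a \<in> mins x \<inter> B" "2 \<le> nblocks x B"
proof -
  from assms(4) obtain B v where *: "(B, v) \<in> y" "a = Min B" "b \<in> mins x \<inter> B" "a < b"
    "\<forall>c\<in>mins x \<inter> B. c = a \<or> b \<le> c" "u \<le> 1"
    "u = 1 \<longleftrightarrow> v + 1 = wsum x B + nblocks x B"
    "\<forall>(D, w)\<in>y. Min D < a \<longrightarrow> nblocks x D = 1"
    unfolding greedy_def by auto
  have a: "a \<in> mins x \<inter> B" using Min_in_mins[OF x y r *(1)] *(2) by simp
  have "card {a, b} \<le> nblocks x B"
    unfolding nblocks_def using a *(3) finite_mins[OF x] by (intro card_mono) auto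
  then have "2 \<le> nblocks x B" using *(4) by simp
  then show ?thesis using that[of B v] * a by blast
qed

lemma greedy_unique:
  assumes x: "x \<in> WP n" and y: "y \<in> WP n" and r: "refines x y" and g: "greedy x y l" "greedy x y l'"
  shows "l = l'"
proof -
  obtain a b u a' b' u' where l: "l = (a, b, u)" "l' = (a', b', u')" by (cases l, cases l')
  obtain B v where B: "(B, v) \<in> y" "a = Min B" "b \<in> mins x \<inter> B" "a < b"
    "\<forall>c. c \<in> mins x \<inter> B \<longrightarrow> c \<noteq> a \<longrightarrow> b \<le> c" "u \<le> 1"
    "u = 1 \<longleftrightarrow> v + 1 = wsum x B + nblocks x B"
    "\<forall>D w. (D, w) \<in> y \<longrightarrow> Min D < a \<longrightarrow> nblocks x D = 1" "2 \<le> nblocks x B"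
    by (rule greedyE[OF x y r g(1)[unfolded l(1)]])
  obtain B' v' where B': "(B', v') \<in> y" "a' = Min B'" "b' \<in> mins x \<inter> B'" "a' < b'"
    "\<forall>c. c \<in> mins x \<inter> B' \<longrightarrow> c \<noteq> a' \<longrightarrow> b' \<le> c" "u' \<le> 1"
    "u' = 1 \<longleftrightarrow> v' + 1 = wsum x B' + nblocks x B'"
    "\<forall>D w. (D, w) \<in> y \<longrightarrow> Min D < a' \<longrightarrow> nblocks x D = 1" "2 \<le> nblocks x B'"
    by (rule greedyE[OF x y r g(2)[unfolded l(2)]])
  \<comment> \<open>Each chosen block has at least two parts, whereas all blocks before the other
    choice have one.\<close>
  have "\<not> a < a'" "\<not> a' < a" using B'(8)[rule_format, OF B(1)] B(8)[rule_format, OF B'(1)] B(2,9) B'(2,9) by auto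
  then have "a = a'" by simp
  then have "B = B'" "v = v'" using WP_Min_inj[OF y B(1) B'(1)] B(2) B'(2) by auto
  have "b \<le> b'" using B(5)[rule_format, of b'] B'(3,4) \<open>a = a'\<close> \<open>B = B'\<close> by simp
  moreover have "b' \<le> b" using B'(5)[rule_format, of b] B(3,4) \<open>a = a'\<close> \<open>B = B'\<close> by simp
  moreover have "u = 1 \<longleftrightarrow> u' = 1" using B(7) B'(7) \<open>B = B'\<close> \<open>v = v'\<close> by simp
  then have "u = u'" using B(6) B'(6) by auto
  ultimately show ?thesis using l \<open>a = a'\<close> by simp
qed

lemma greedy_exists:
  assumes x: "x \<in> WP n" and y: "y \<in> WP n" and xy: "wbelow x y" and "x \<noteq> y"
  shows "\<exists>l. greedy x y l"
proof -
  have r: "refines x y" using xy unfolding wbelow_def by blast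
  let ?P = "\<lambda>p. p \<in> y \<and> nblocks x (fst p) \<noteq> 1"
  have "\<exists>p. ?P p" using wbelow_all_trivial[OF x y xy] \<open>x \<noteq> y\<close> by fastforce
  then obtain p where p: "?P p" "\<And>q. ?P q \<Longrightarrow> Min (fst p) \<le> Min (fst q)"
    using ex_has_least_nat[of ?P _ "\<lambda>p. Min (fst p)"] by blast
  obtain B v where Bv: "p = (B, v)" by (cases p)
  then have B: "(B, v) \<in> y" "nblocks x B \<noteq> 1" using p(1) by auto
  let ?S = "mins x \<inter> B - {Min B}"
  have fin: "finite ?S" using finite_mins[OF x] by simp
  have ne: "?S \<noteq> {}"
    using nblocks_eq_1_iff[OF x y r B(1)] B(2) Min_in_mins[OF x y r B(1)] by blast
  define b where "b = Min ?S"
  have b: "b \<in> ?S" unfolding b_def using fin ne by (rule Min_in)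
  have least: "b \<le> c" if "c \<in> ?S" for c unfolding b_def using fin that by (rule Min_le)
  have "Min B \<le> b" using b WP_block(2)[OF y B(1)] by simp
  then have "Min B < b" using b by auto
  moreover have "nblocks x D = 1" if "(D, w) \<in> y" "Min D < Min B" for D w
    using p(2)[of "(D, w)"] that Bv by auto
  ultimately have "greedy x y (Min B, b, if v + 1 = wsum x B + nblocks x B then 1 else 0)"
    using B(1) b least by (intro greedyI[of B v]) auto
  then show ?thesis by blast
qed

lemma greedy_wstep:
  assumes x: "x \<in> WP n" and y: "y \<in> WP n" and xy: "wbelow x y" and g: "greedy x y l"
  shows "\<exists>x1. wstep x l x1 \<and> wbelow x1 y"
proof -
  have r: "refines x y" using xy unfolding wbelow_def by blast
  obtain a b u where l: "l = (a, b, u)" by (cases l)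
  obtain B v where B: "(B, v) \<in> y" "a = Min B" "b \<in> mins x \<inter> B" "a < b" "u \<le> 1"
    "u = 1 \<longleftrightarrow> v + 1 = wsum x B + nblocks x B" "a \<in> mins x \<inter> B" "2 \<le> nblocks x B"
    by (rule greedyE[OF x y r g[unfolded l]])
  obtain C wC where C: "(C, wC) \<in> x" "a = Min C" using B(7) minsE by blast
  obtain D wD where D: "(D, wD) \<in> x" "b = Min D" using B(3) minsE by blast
  let ?x1 = "(x - {(C, wC), (D, wD)}) \<union> {(C \<union> D, wC + wD + u)}"
  have s: "wstep x (a, b, u) ?x1"
    unfolding wstep_def using C D B(4,5) by metis
  have r1: "refines ?x1 y"
    using wstep_refines[OF x s y] r B(1,3,7) by blast
  obtain B' v' where B': "(B', v') \<in> y" "a \<in> B'"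
    "nblocks x B' = nblocks ?x1 B' + 1" "wsum ?x1 B' = wsum x B' + u"
    "\<forall>D w. (D, w) \<in> y \<longrightarrow> D \<noteq> B' \<longrightarrow>
       a \<notin> D \<and> b \<notin> D \<and> nblocks x D = nblocks ?x1 D \<and> wsum ?x1 D = wsum x D"
    by (rule wstep_block_counts[OF x s y r1])
  have B'_eq: "B' = B" using B'(5)[rule_format, OF B(1)] B(7) by blast
  have "wsum ?x1 E \<le> w \<and> w + 1 \<le> wsum ?x1 E + nblocks ?x1 E" if E: "(E, w) \<in> y" for E w
  proof -
    have d: "wsum x E \<le> w \<and> w + 1 \<le> wsum x E + nblocks x E"
      using xy E unfolding wbelow_def by blast
    show ?thesis
    proof (cases "E = B")
      case True
      then have "w = v"
        using WP_disjoint(2)[OF y E B(1)] WP_block(5)[OF y B(1)] by blast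
      \<comment> \<open>For \<open>u = 1\<close> the weight is S + t - 1 with t >= 2, hence at least
        S + 1; for \<open>u = 0\<close> it is at most S + t - 2, the upper bound after the
        merge.\<close>
      then show ?thesis
        using d True B'(3,4) B'_eq B(5,6,8) by (cases "u = 1") auto
    next
      case False
      then show ?thesis using d B'(5)[rule_format, OF E] B'_eq by simp
    qed
  qed
  then have "wbelow ?x1 y" using r1 unfolding wbelow_def by blast
  then show ?thesis using s l by blast
qed

text \<open>The merge completing \<open>B\<close> joins its only two parts, and with one part left
  the weight bounds fix the increment; so nothing was left to choose.\<close>

lemma wstep_last_greedy:
  assumes x: "x \<in> WP n" and y: "y \<in> WP n" and s: "wstep x (a, b, u) x1" and below: "wbelow x1 y"
    and B: "(B, v) \<in> y" "a \<in> B" "nblocks x1 B = 1"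
    and triv: "\<And>D w. (D, w) \<in> y \<Longrightarrow> Min D < Min B \<Longrightarrow> nblocks x1 D = 1"
  shows "greedy x y (a, b, u)"
proof -
  have x1: "x1 \<in> WP n" by (rule wstep_WP[OF x s])
  have r1: "refines x1 y" using below unfolding wbelow_def by blast
  obtain B' v' where B': "(B', v') \<in> y" "a \<in> B'" "b \<in> B'"
    "nblocks x B' = nblocks x1 B' + 1" "wsum x1 B' = wsum x B' + u"
    "\<forall>D w. (D, w) \<in> y \<longrightarrow> D \<noteq> B' \<longrightarrow>
       a \<notin> D \<and> b \<notin> D \<and> nblocks x D = nblocks x1 D \<and> wsum x1 D = wsum x D"
    by (rule wstep_block_counts[OF x s y r1])
  have B'_eq: "B' = B" using B'(6)[rule_format, OF B(1)] B(2) by blast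
  note m = wstep_mins[OF x s]
  have m1: "mins x1 \<inter> B = {Min B}"
    using nblocks_eq_1_iff[OF x1 y r1 B(1)] B(3) by blast
  have "a \<in> mins x1 \<inter> B" using m(1,3,5) B(2) by simp
  then have a: "a = Min B" using m1 by simp
  have mx: "mins x \<inter> B = {a, b}"
    using m1 m(2,5) B'(3) B'_eq a by auto
  have "wsum x1 B \<le> v \<and> v + 1 \<le> wsum x1 B + nblocks x1 B"
    using below B(1) unfolding wbelow_def by blast
  then have "u = 1 \<longleftrightarrow> v + 1 = wsum x B + nblocks x B"
    using B'(4,5) B'_eq B(3) by auto
  moreover have "nblocks x D = 1" if D: "(D, w) \<in> y" "Min D < a" for D w
    using triv[OF D(1)] B'(6)[rule_format, OF D(1)] D(2) a B'_eq by auto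
  ultimately show ?thesis
    using B(1) a mx m(3,4) by (intro greedyI[of B v]) auto
qed

text \<open>This is the heart of the ER property. If both merges lie in the same block of
  \<open>y\<close>, the first is greedy exactly if it uses the minimum of that block, takes its
  second part before the next one, and does not put an increment 1 before a 0. If they lie in
  different blocks, only the order of the blocks counts.\<close>

lemma greedy_iff_less:
  assumes x: "x \<in> WP n" and y: "y \<in> WP n" and s: "wstep x (a, b, u) x1" and below: "wbelow x1 y"
    and g1: "greedy x1 y (a1, b1, u1)"
  shows "greedy x y (a, b, u) \<longleftrightarrow> a < a1 \<or> a = a1 \<and> b < b1 \<and> u \<le> u1"
proof -
  have x1: "x1 \<in> WP n" by (rule wstep_WP[OF x s])
  have r1: "refines x1 y" using below unfolding wbelow_def by blast
  have r: "refines x y" using wstep_refines[OF x s y] r1 by blast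
  obtain B v where B: "(B, v) \<in> y" "a \<in> B" "b \<in> B"
    "nblocks x B = nblocks x1 B + 1" "wsum x1 B = wsum x B + u"
    "\<forall>D w. (D, w) \<in> y \<longrightarrow> D \<noteq> B \<longrightarrow>
       a \<notin> D \<and> b \<notin> D \<and> nblocks x D = nblocks x1 D \<and> wsum x1 D = wsum x D"
    by (rule wstep_block_counts[OF x s y r1])
  obtain B1 v1 where B1: "(B1, v1) \<in> y" "a1 = Min B1" "b1 \<in> mins x1 \<inter> B1" "a1 < b1"
    "\<forall>c. c \<in> mins x1 \<inter> B1 \<longrightarrow> c \<noteq> a1 \<longrightarrow> b1 \<le> c" "u1 \<le> 1"
    "u1 = 1 \<longleftrightarrow> v1 + 1 = wsum x1 B1 + nblocks x1 B1"
    "\<forall>D w. (D, w) \<in> y \<longrightarrow> Min D < a1 \<longrightarrow> nblocks x1 D = 1"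
    "a1 \<in> mins x1 \<inter> B1" "2 \<le> nblocks x1 B1"
    by (rule greedyE[OF x1 y r1 g1])
  note m = wstep_mins[OF x s]
  have MinB: "Min B \<le> a" using B(2) WP_block(2)[OF y B(1)] by simp
  show ?thesis
  proof (cases "B1 = B")
    case True
    have v1: "v1 = v"
      using WP_disjoint(2)[OF y B1(1) B(1)] WP_block(5)[OF y B(1)] True by blast
    have bounds: "v + 1 \<le> wsum x1 B + nblocks x1 B"
      using below B(1) unfolding wbelow_def by blast
    show ?thesis
    proof
      assume "greedy x y (a, b, u)"
      then obtain B0 v0 where B0: "(B0, v0) \<in> y" "a = Min B0"
        "\<forall>c. c \<in> mins x \<inter> B0 \<longrightarrow> c \<noteq> a \<longrightarrow> b \<le> c"
        "u = 1 \<longleftrightarrow> v0 + 1 = wsum x B0 + nblocks x B0" "a \<in> mins x \<inter> B0"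
        by (rule greedyE[OF x y r])
      have "B0 = B" using B(6)[rule_format, OF B0(1)] B0(5) by blast
      then have "v0 = v"
        using WP_disjoint(2)[OF y B0(1) B(1)] WP_block(5)[OF y B(1)] by blast
      have a: "a = a1" using B0(2) B1(2) \<open>B0 = B\<close> True by simp
      have "b \<le> b1" using B0(3)[rule_format, of b1] B1(3,4) m(5) \<open>B0 = B\<close> True a by simp
      moreover have "b \<noteq> b1" using B1(3) m(5) by blast
      moreover have "u \<le> u1"
        using B0(4) \<open>v0 = v\<close> \<open>B0 = B\<close> B(4,5) B1(7) True v1 m(4) by auto
      ultimately show "a < a1 \<or> a = a1 \<and> b < b1 \<and> u \<le> u1" using a by simp
    next
      assume "a < a1 \<or> a = a1 \<and> b < b1 \<and> u \<le> u1"
      then have l: "a = Min B" "a = a1" "b < b1" "u \<le> u1"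
        using MinB B1(2) True by auto
      have "c = a \<or> b \<le> c" if c: "c \<in> mins x \<inter> B" for c
        using c B1(5)[rule_format, of c] l m(5) True by fastforce
      \<comment> \<open>A merge with increment 1 keeps the upper bound for the weight, one with
        increment 0 lowers it by 1. So a weight at the bound stays there and forces only increments
        1.\<close>
      moreover have "u = 1 \<longleftrightarrow> v + 1 = wsum x B + nblocks x B"
      proof
        assume "u = 1"
        then have "u1 = 1" using l(4) B1(6) by simp
        then show "v + 1 = wsum x B + nblocks x B"
          using B1(7) \<open>u = 1\<close> B(4,5) True v1 by simp
      next
        assume "v + 1 = wsum x B + nblocks x B"
        then show "u = 1" using bounds B(4,5) m(4) by simp
      qed
      moreover have "nblocks x D = 1" if D: "(D, w) \<in> y" "Min D < a" for D w
        using B1(8)[rule_format, OF D(1)] B(6)[rule_format, OF D(1)] D(2) l by auto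
      ultimately show "greedy x y (a, b, u)"
        using B(1,3) l(1) m(2,3,4) by (intro greedyI[of B v]) simp_all
    qed
  next
    case False
    show ?thesis
    proof
      assume "greedy x y (a, b, u)"
      then obtain B0 v0 where B0: "(B0, v0) \<in> y" "a = Min B0" "a \<in> mins x \<inter> B0"
        "\<forall>D w. (D, w) \<in> y \<longrightarrow> Min D < a \<longrightarrow> nblocks x D = 1"
        by (rule greedyE[OF x y r])
      have "nblocks x B1 \<noteq> 1" using B(6)[rule_format, OF B1(1) False] B1(10) by simp
      then have "\<not> a1 < a" using B0(4)[rule_format, OF B1(1)] B1(2) by blast
      moreover have "a1 \<noteq> a" using B(6)[rule_format, OF B1(1) False] B1(9) by blast
      ultimately show "a < a1 \<or> a = a1 \<and> b < b1 \<and> u \<le> u1" by simp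
    next
      assume "a < a1 \<or> a = a1 \<and> b < b1 \<and> u \<le> u1"
      moreover have "a1 \<noteq> a" using B(6)[rule_format, OF B1(1) False] B1(9) by blast
      \<comment> \<open>As \<open>B\<close> comes before the block merged next, it is complete in
        \<open>x1\<close>, so this merge was the last one in it.\<close>
      ultimately have "Min B < a1" using MinB by auto
      then show "greedy x y (a, b, u)"
        using B1(8)[rule_format, OF B(1)] B1(8) by (intro wstep_last_greedy[OF x y s below B(1,2)]) auto
    qed
  qed
qed

section \<open>The order and its rank function\<close>

lemma wle_imp_wbelow:
  assumes "wle n x y"
  shows "wbelow x y"
proof -
  have y: "y \<in> WP n" and "(wcov n)\<^sup>*\<^sup>* x y" using assms unfolding wle_def by auto
  from this(2) show ?thesis
  proof (induction rule: converse_rtranclp_induct)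
    case base
    show ?case by (rule wbelow_refl[OF y])
  next
    case (step x x1)
    obtain l where x: "x \<in> WP n" and s: "wstep x l x1"
      using step.hyps(1) wcov_iff by blast
    obtain a b u where l: "l = (a, b, u)" by (cases l)
    show ?case
      using wstep_wbelow[OF x s[unfolded l] y] step by blast
  qed
qed

text \<open>A greedy merge stays below \<open>y\<close> and exists as long as \<open>y\<close> is
  not reached.\<close>

lemma wbelow_imp_wle:
  assumes "x \<in> WP n" "y \<in> WP n" "wbelow x y"
  shows "wle n x y"
  using assms(1,3)
proof (induction "card x" arbitrary: x rule: less_induct)
  case less
  show ?case
  proof (cases "x = y")
    case True
    then show ?thesis using assms(2) unfolding wle_def by simp
  next
    case False
    obtain l where l: "greedy x y l"
      using greedy_exists[OF less.prems(1) assms(2) less.prems(2) False] by blast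
    obtain x1 where x1: "wstep x l x1" "wbelow x1 y"
      using greedy_wstep[OF less.prems(1) assms(2) less.prems(2) l] by blast
    have "card x1 < card x" using wstep_card[OF less.prems(1) x1(1)] by simp
    then have "wle n x1 y" using less.hyps wstep_WP[OF less.prems(1) x1(1)] x1(2) by blast
    moreover have "wcov n x x1" using wcov_iff less.prems(1) x1(1) by blast
    ultimately show ?thesis
      using less.prems(1) converse_rtranclp_into_rtranclp[of "wcov n" x x1 y] unfolding wle_def
      by blast
  qed
qed

lemma wle_cases:
  assumes "wle n x y" "x \<noteq> y"
  obtains l x1 where "wstep x l x1" "wle n x1 y"
proof -
  have xy: "x \<in> WP n" "y \<in> WP n" and c: "(wcov n)\<^sup>*\<^sup>* x y" using assms unfolding wle_def by auto
  from c show ?thesis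
  proof (cases rule: converse_rtranclpE)
    case base
    then show ?thesis using assms(2) by simp
  next
    case (step x1)
    then obtain l where l: "wstep x l x1" using wcov_iff by blast
    then show ?thesis
      using that[OF l] xy(2) step(2) wstep_WP[OF xy(1) l] unfolding wle_def by blast
  qed
qed

lemma wle_card:
  assumes "wle n x y"
  shows "card y \<le> card x" "x \<noteq> y \<Longrightarrow> card y < card x"
proof -
  have "card y \<le> card x \<and> (x \<noteq> y \<longrightarrow> card y < card x)"
    using assms
  proof (induction "card x" arbitrary: x rule: less_induct)
    case less
    show ?case
    proof (cases "x = y")
      case False
      obtain l x1 where x1: "wstep x l x1" "wle n x1 y"
        by (rule wle_cases[OF less.prems False])
      have "card x = Suc (card x1)"
        using wstep_card[OF _ x1(1)] less.prems unfolding wle_def by blast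
      moreover from this have "card y \<le> card x1" using less.hyps[OF _ x1(2)] by simp
      ultimately show ?thesis by simp
    qed simp
  qed
  then show "card y \<le> card x" "x \<noteq> y \<Longrightarrow> card y < card x" by auto
qed

text \<open>Each merge loses exactly one block, so nothing fits in between; conversely the first
  merge on the way up already reaches the top of a cover.\<close>

lemma covers_iff: "covers (WP n) (wle n) x y \<longleftrightarrow> x \<in> WP n \<and> (\<exists>l. wstep x l y)"
proof
  assume c: "covers (WP n) (wle n) x y"
  then have x: "x \<in> WP n" and xy: "wle n x y" "x \<noteq> y"
    unfolding covers_def strict_def by auto
  obtain l x1 where x1: "wstep x l x1" "wle n x1 y" by (rule wle_cases[OF xy])
  have x1P: "x1 \<in> WP n" by (rule wstep_WP[OF x x1(1)])
  have "wcov n x x1" using wcov_iff x x1(1) by blast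
  then have "wle n x x1" using x x1P unfolding wle_def by auto
  moreover have "x \<noteq> x1" using wstep_card[OF x x1(1)] by auto
  ultimately have "x1 = y"
    using c x1(2) x1P unfolding covers_def strict_def by blast
  then show "x \<in> WP n \<and> (\<exists>l. wstep x l y)" using x x1(1) by blast
next
  assume "x \<in> WP n \<and> (\<exists>l. wstep x l y)"
  then obtain l where x: "x \<in> WP n" and l: "wstep x l y" by blast
  have y: "y \<in> WP n" by (rule wstep_WP[OF x l])
  have card: "card x = Suc (card y)" by (rule wstep_card[OF x l])
  have "wcov n x y" using wcov_iff x l by blast
  then have "wle n x y" using x y unfolding wle_def by auto
  moreover have "x \<noteq> y" using card by auto
  moreover have "\<not> (strict (wle n) x z \<and> strict (wle n) z y)" for z
  proof
    assume "strict (wle n) x z \<and> strict (wle n) z y"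
    then have "card z < card x" "card y < card z"
      using wle_card(2) unfolding strict_def by blast+
    then show False using card by simp
  qed
  ultimately show "covers (WP n) (wle n) x y"
    using x y unfolding covers_def strict_def by blast
qed

lemma covers_lamE:
  assumes "covers (WP n) (wle n) x y"
  shows "x \<in> WP n" "y \<in> WP n" "wstep x (lamE x y) y"
proof -
  obtain l where x: "x \<in> WP n" and l: "wstep x l y" using assms covers_iff by blast
  then show "x \<in> WP n" "y \<in> WP n" "wstep x (lamE x y) y"
    using wstep_WP[OF x l] lamE_eq[OF x l] by simp_all
qed

lemma wstep_covers: "x \<in> WP n \<Longrightarrow> wstep x l y \<Longrightarrow> covers (WP n) (wle n) x y"
  using covers_iff by blast

lemma wbot_in: "wbot n \<in> WP n"
  unfolding WP_def wbot_def by auto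

lemma mins_wbot: "mins (wbot n) = {1..n}"
  unfolding mins_def wbot_def by (auto simp: image_image)

text \<open>Over singletons of weight 0 the test for a block B^v reads 0 <= v <= |B| - 1, which is
  the weight condition for weighted partitions.\<close>

lemma wbot_le:
  assumes y: "y \<in> WP n"
  shows "wle n (wbot n) y"
proof (rule wbelow_imp_wle[OF wbot_in y])
  have "refines (wbot n) y"
    unfolding refines_def
  proof
    fix p assume "p \<in> wbot n"
    then obtain i where i: "i \<in> {1..n}" "p = ({i}, 0)" unfolding wbot_def by blast
    obtain A w where "(A, w) \<in> y" "i \<in> A" by (rule WP_cover[OF y i(1)])
    then show "case p of (A, w) \<Rightarrow> \<exists>(B, v)\<in>y. A \<subseteq> B" using i(2) by auto
  qed
  moreover have "wsum (wbot n) B \<le> v \<and> v + 1 \<le> wsum (wbot n) B + nblocks (wbot n) B"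
    if B: "(B, v) \<in> y" for B v
  proof -
    have "wsum (wbot n) B = 0" unfolding wsum_def wbot_def by (intro sum.neutral) auto
    moreover have "mins (wbot n) \<inter> B = B" using mins_wbot WP_block(3)[OF y B] by auto
    then have "nblocks (wbot n) B = card B" unfolding nblocks_def by simp
    ultimately show ?thesis using WP_block(4)[OF y B] by simp
  qed
  ultimately show "wbelow (wbot n) y" unfolding wbelow_def by blast
qed

definition wrank :: "nat \<Rightarrow> wpart \<Rightarrow> nat" where
  "wrank n x = n - card x"

interpretation WP: ranked_poset "WP n" "wle n" "wbot n" "wrank n" for n
proof
  show "finite (WP n)" by (rule finite_WP)
  show "wbot n \<in> WP n" by (rule wbot_in)
  show "wle n (wbot n) x" if "x \<in> WP n" for x using wbot_le[OF that] .
  show "partial_order_on (WP n) (wle n)"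
    unfolding partial_order_on_def
  proof (intro conjI ballI impI)
    fix x assume "x \<in> WP n"
    then show "wle n x x" unfolding wle_def by simp
  next
    fix x y assume "wle n x y \<and> wle n y x"
    then show "x = y" using wle_card(2)[of n x y] wle_card(1)[of n y x] by linarith
  next
    fix x y z assume "wle n x y \<and> wle n y z"
    then show "wle n x z" using rtranclp_trans[of "wcov n" x y z] unfolding wle_def by blast
  qed
  show "wrank n (wbot n) = 0"
    using card_mins[OF wbot_in[of n]] mins_wbot[of n] unfolding wrank_def by simp
  show "wrank n y = Suc (wrank n x)" if "covers (WP n) (wle n) x y" for x y
    using covers_lamE[OF that] wstep_card[of x n] card_WP_le[of x n] unfolding wrank_def by fastforce
qed

section \<open>The labeling\<close>

interpretation lab: strict_order "lab_lt n" for n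
proof
  show "\<not> lab_lt n a a" for a unfolding lab_lt_def by simp
  show "lab_lt n a c" if "lab_lt n a b" "lab_lt n b c" for a b c
    using that unfolding lab_lt_def lab_le_def by (auto split: prod.splits)
qed

section \<open>Increasing chains as chains of forced merges\<close>

lemma wstep_in_Lambda:
  assumes x: "x \<in> WP n" and s: "wstep x (a, b, u) y"
  shows "(a, b, u) \<in> Lambda n"
proof -
  note m = wstep_mins[OF x s]
  have "a \<in> {1..n}" "b \<in> {1..n}" using m(1,2) mins_subset[OF x] by auto
  then show ?thesis using m(3,4) unfolding Lambda_def by auto
qed

lemma lab_lt_greedy_iff:
  assumes x: "x \<in> WP n" and y: "y \<in> WP n" and s: "wstep x l x1" and s1: "wstep x1 l1 x2"
    and below: "wbelow x1 y" and g1: "greedy x1 y l1"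
  shows "lab_lt n l l1 \<longleftrightarrow> greedy x y l"
proof -
  obtain a b u a1 b1 u1 where l: "l = (a, b, u)" "l1 = (a1, b1, u1)" by (cases l, cases l1)
  have x1: "x1 \<in> WP n" by (rule wstep_WP[OF x s])
  \<comment> \<open>The minimum \<open>b\<close> has disappeared after the first merge, so the
    labels differ and the comparison of second entries is strict.\<close>
  have "b \<noteq> b1"
    using wstep_mins(5)[OF x s[unfolded l]] wstep_mins(2)[OF x1 s1[unfolded l]] by blast
  moreover have "l \<in> Lambda n" "l1 \<in> Lambda n"
    using wstep_in_Lambda x x1 s s1 l by blast+
  ultimately have "lab_lt n l l1 \<longleftrightarrow> a < a1 \<or> a = a1 \<and> b < b1 \<and> u \<le> u1"
    unfolding lab_lt_def lab_le_def l by auto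
  then show ?thesis
    using greedy_iff_less[OF x y s[unfolded l] below g1[unfolded l]] l by simp
qed

text \<open>Induction from the top: the last merge is forced, and each ascent passes greediness down
  to the preceding merge.\<close>

lemma increasing_imp_greedy:
  assumes "satchain (WP n) (wle n) x y (x # x1 # cs)"
    and "successively (lab_lt n) (lword lamE (x # x1 # cs))"
  shows "greedy x y (lamE x x1)"
  using assms
proof (induction cs arbitrary: x x1)
  case Nil
  have c: "covers (WP n) (wle n) x x1" "x1 = y"
    using Nil.prems(1) unfolding satchain_def by auto
  note x = covers_lamE[OF c(1)]
  obtain a b u where l: "lamE x x1 = (a, b, u)" by (cases "lamE x x1")
  note s = x(3)[unfolded l]
  have y: "y \<in> WP n" using x(2) c(2) by simp
  have below: "wbelow x1 y" using wbelow_refl[OF y] c(2) by simp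
  have r: "refines x1 y" using below unfolding wbelow_def by blast
  have triv: "nblocks x1 D = 1" if "(D, w) \<in> y" for D w
  proof -
    have D: "wsum x1 D \<le> w \<and> w + 1 \<le> wsum x1 D + nblocks x1 D"
      using below that unfolding wbelow_def by blast
    have "mins x1 \<inter> D = {Min D}"
    proof (intro equalityI subsetI)
      fix c assume c': "c \<in> mins x1 \<inter> D"
      then obtain C v where C: "(C, v) \<in> y" "c = Min C" using c(2) minsE by blast
      then show "c \<in> {Min D}"
        using WP_disjoint(1)[OF y C(1) that, of c] WP_block(5)[OF y C(1)] c' by blast
    next
      fix c assume "c \<in> {Min D}"
      then show "c \<in> mins x1 \<inter> D" using Min_in_mins[OF x(2) y r that] by simp
    qed
    then show ?thesis unfolding nblocks_def by simp
  qed
  obtain B v where "(B, v) \<in> y" "a \<in> B"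
    using wstep_refines[OF x(1) s y] r by blast
  then show ?case
    unfolding l using triv by (intro wstep_last_greedy[OF x(1) y s below]) auto
next
  case (Cons x2 cs)
  have c: "covers (WP n) (wle n) x x1" "covers (WP n) (wle n) x1 x2"
    and sat: "satchain (WP n) (wle n) x1 y (x1 # x2 # cs)"
    using Cons.prems(1) unfolding satchain_def by auto
  have inc: "successively (lab_lt n) (lword lamE (x1 # x2 # cs))"
    and lt: "lab_lt n (lamE x x1) (lamE x1 x2)"
    using Cons.prems(2) by auto
  note x = covers_lamE[OF c(1)] and x1 = covers_lamE[OF c(2)]
  have y: "y \<in> WP n" using WP.satchain_in(2)[OF sat] .
  have "wbelow x1 y" using WP.satchain_le[OF sat] wle_imp_wbelow by blast
  then show ?case
    using lab_lt_greedy_iff[OF x(1) y x(3) x1(3) _ Cons.IH[OF sat inc]] lt by blast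
qed

lemma satchain_refl_only:
  assumes "satchain (WP n) (wle n) x x c"
  shows "c = [x]"
proof -
  have "length c = Suc 0" using WP.rk_satchain_last[OF assms] by simp
  then obtain a where "c = [a]" by (auto simp: length_Suc_conv)
  then show ?thesis using assms unfolding satchain_def by simp
qed

lemma satchain_step:
  assumes "satchain (WP n) (wle n) x y c" "x \<noteq> y"
  obtains x1 cs where "c = x # x1 # cs" "covers (WP n) (wle n) x x1"
    "satchain (WP n) (wle n) x1 y (x1 # cs)"
proof -
  obtain d where c: "c = x # d" using assms(1) unfolding satchain_def by (cases c) auto
  moreover from this obtain x1 cs where "d = x1 # cs"
    using assms unfolding satchain_def by (cases d) auto
  ultimately show ?thesis using that assms(1) unfolding satchain_def by auto
qed

lemma increasing_chain_WP_unique: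
  assumes "satchain (WP n) (wle n) x y c" "satchain (WP n) (wle n) x y d"
    and "successively (lab_lt n) (lword lamE c)" "successively (lab_lt n) (lword lamE d)"
  shows "c = d"
  using assms
proof (induction c arbitrary: x d)
  case (Cons c0 c)
  show ?case
  proof (cases "x = y")
    case True
    then show ?thesis using satchain_refl_only Cons.prems(1,2) by metis
  next
    case False
    obtain x1 cs where c: "c0 # c = x # x1 # cs" "covers (WP n) (wle n) x x1"
      "satchain (WP n) (wle n) x1 y (x1 # cs)"
      by (rule satchain_step[OF Cons.prems(1) False])
    obtain x1' ds where d: "d = x # x1' # ds" "covers (WP n) (wle n) x x1'"
      "satchain (WP n) (wle n) x1' y (x1' # ds)"
      by (rule satchain_step[OF Cons.prems(2) False])
    note x = covers_lamE[OF c(2)] and x' = covers_lamE[OF d(2)]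
    have "greedy x y (lamE x x1)" "greedy x y (lamE x x1')"
      using increasing_imp_greedy[of n x y x1 cs] increasing_imp_greedy[of n x y x1' ds]
        Cons.prems c(1) d(1) by simp_all
    moreover have "wbelow x y"
      using WP.satchain_le[OF Cons.prems(1)] by (rule wle_imp_wbelow)
    then have "refines x y" unfolding wbelow_def by blast
    ultimately have "lamE x x1 = lamE x x1'"
      using greedy_unique[OF x(1) WP.satchain_in(2)[OF c(3)]] by blast
    then have "x1 = x1'" using wstep_target_unique[OF x(1) x(3)] x'(3) by simp
    moreover have "c = x1' # ds"
    proof (rule Cons.IH)
      show "satchain (WP n) (wle n) x1' y c" using c \<open>x1 = x1'\<close> by simp
      show "successively (lab_lt n) (lword lamE c)"
        using Cons.prems(3) c(1) by (cases cs) auto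
      show "successively (lab_lt n) (lword lamE (x1' # ds))"
        using Cons.prems(4) d(1) by (cases ds) auto
    qed (rule d(3))
    ultimately show ?thesis using c(1) d(1) by simp
  qed
qed (simp add: satchain_def)

lemma increasing_chain_WP_exists:
  assumes "x \<in> WP n" "y \<in> WP n" "wbelow x y"
  shows "\<exists>c. satchain (WP n) (wle n) x y c \<and> successively (lab_lt n) (lword lamE c)"
  using assms(1,3)
proof (induction "card x" arbitrary: x rule: less_induct)
  case less
  show ?case
  proof (cases "x = y")
    case True
    then show ?thesis using satchain_single[OF assms(2)] by (intro exI[of _ "[x]"]) simp
  next
    case False
    obtain l where l: "greedy x y l"
      using greedy_exists[OF less.prems(1) assms(2) less.prems(2) False] by blast
    obtain x1 where x1: "wstep x l x1" "wbelow x1 y"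
      using greedy_wstep[OF less.prems(1) assms(2) less.prems(2) l] by blast
    have x1P: "x1 \<in> WP n" by (rule wstep_WP[OF less.prems(1) x1(1)])
    have "card x1 < card x" using wstep_card[OF less.prems(1) x1(1)] by simp
    then obtain c where c: "satchain (WP n) (wle n) x1 y c"
      "successively (lab_lt n) (lword lamE c)"
      using less.hyps[of x1] x1P x1(2) by blast
    have cov: "covers (WP n) (wle n) x x1" by (rule wstep_covers[OF less.prems(1) x1(1)])
    have lam: "lamE x x1 = l" by (rule lamE_eq[OF less.prems(1) x1(1)])
    have "successively (lab_lt n) (lword lamE (x # c))"
    proof (cases "x1 = y")
      case True
      then have "c = [x1]" using satchain_refl_only c(1) by simp
      then show ?thesis by simp
    next
      case False
      obtain x2 cs where cs: "c = x1 # x2 # cs" "covers (WP n) (wle n) x1 x2"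
        by (rule satchain_step[OF c(1) False])
      have "greedy x1 y (lamE x1 x2)"
        using increasing_imp_greedy c cs(1) by blast
      \<comment> \<open>Here the equivalence is read the other way: a greedy merge followed by an
        increasing, hence greedy, chain makes an ascent at the joint.\<close>
      then have "lab_lt n l (lamE x1 x2)"
        using lab_lt_greedy_iff[OF less.prems(1) assms(2) x1(1) covers_lamE(3)[OF cs(2)] x1(2)] l
        by blast
      then show ?thesis using c(2) cs(1) lam by simp
    qed
    then show ?thesis using satchain_Cons[OF cov c(1)] by blast
  qed
qed

lemma lword_WP_inj:
  assumes "satchain (WP n) (wle n) x y c" "satchain (WP n) (wle n) x y d"
    and "lword lamE c = lword lamE d"
  shows "c = d"
  using assms
proof (induction c arbitrary: x d)
  case (Cons c0 c)
  show ?case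
  proof (cases "x = y")
    case True
    then show ?thesis using satchain_refl_only Cons.prems(1,2) by metis
  next
    case False
    obtain x1 cs where c: "c0 # c = x # x1 # cs" "covers (WP n) (wle n) x x1"
      "satchain (WP n) (wle n) x1 y (x1 # cs)"
      by (rule satchain_step[OF Cons.prems(1) False])
    obtain x1' ds where d: "d = x # x1' # ds" "covers (WP n) (wle n) x x1'"
      "satchain (WP n) (wle n) x1' y (x1' # ds)"
      by (rule satchain_step[OF Cons.prems(2) False])
    note x = covers_lamE[OF c(2)] and x' = covers_lamE[OF d(2)]
    have l: "lamE x x1 = lamE x x1'" "lword lamE (x1 # cs) = lword lamE (x1' # ds)"
      using Cons.prems(3) unfolding c(1) d(1) by simp_all
    then have "x1 = x1'" using wstep_target_unique[OF x(1) x(3)] x'(3) by simp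
    moreover have "c = x1' # ds"
      using Cons.IH[of x1' "x1' # ds"] c d(3) l(2) \<open>x1 = x1'\<close> by simp
    ultimately show ?thesis using c(1) d(1) by simp
  qed
qed (simp add: satchain_def)

lemma rank_two_switching_WP: "rank_two_switching (WP n) (wle n) (wbot n) lamE (lab_lt n)"
  unfolding rank_two_switching_def
proof (intro allI impI)
  fix cs y i
  assume sat: "satchain (WP n) (wle n) (wbot n) y cs" and i: "0 < i" "Suc i < length cs"
    and lt: "lab_lt n (lamE (cs ! (i - 1)) (cs ! i)) (lamE (cs ! i) (cs ! Suc i))"
  let ?x = "cs ! (i - 1)" and ?x1 = "cs ! i" and ?x2 = "cs ! Suc i"
  have "covers (WP n) (wle n) (cs ! (i - 1)) (cs ! Suc (i - 1))"
    by (rule satchain_nth_covers[OF sat]) (use i in simp)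
  then have c: "covers (WP n) (wle n) ?x ?x1" using i(1) by simp
  have c1: "covers (WP n) (wle n) ?x1 ?x2" by (rule satchain_nth_covers[OF sat i(2)])
  note x = covers_lamE[OF c] and x1 = covers_lamE[OF c1]
  obtain a b u where l: "lamE ?x ?x1 = (a, b, u)" by (cases "lamE ?x ?x1")
  obtain a' b' u' where l1: "lamE ?x1 ?x2 = (a', b', u')" by (cases "lamE ?x1 ?x2")
  \<comment> \<open>An ascent puts the first entries in weak order, and then the two merges can be
    performed in the opposite order.\<close>
  have "a \<le> a'" using lt unfolding l l1 lab_lt_def lab_le_def by auto
  then obtain z where z: "wstep ?x (a', b', u') z" "wstep z (a, b, u) ?x2"
    using wstep_switch[OF x(1) x(3)[unfolded l] x1(3)[unfolded l1]] by blast
  have zP: "z \<in> WP n" by (rule wstep_WP[OF x(1) z(1)])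
  show "\<exists>!x'. covers (WP n) (wle n) ?x x' \<and> covers (WP n) (wle n) x' ?x2 \<and>
      lamE ?x x' = lamE ?x1 ?x2 \<and> lamE x' ?x2 = lamE ?x ?x1"
  proof (rule ex1I[of _ z])
    show "covers (WP n) (wle n) ?x z \<and> covers (WP n) (wle n) z ?x2 \<and>
      lamE ?x z = lamE ?x1 ?x2 \<and> lamE z ?x2 = lamE ?x ?x1"
      using wstep_covers[OF x(1) z(1)] wstep_covers[OF zP z(2)] lamE_eq[OF x(1) z(1)]
        lamE_eq[OF zP z(2)] l l1 by simp
  next
    fix x' assume x': "covers (WP n) (wle n) ?x x' \<and> covers (WP n) (wle n) x' ?x2 \<and>
      lamE ?x x' = lamE ?x1 ?x2 \<and> lamE x' ?x2 = lamE ?x ?x1"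
    then have "wstep ?x (a', b', u') x'" using covers_lamE(3)[of n ?x x'] l1 by simp
    then show "x' = z" using wstep_target_unique[OF x(1) _ z(1)] by blast
  qed
qed

lemma EW_labeling_WP: "EW_labeling (WP n) (wle n) (wbot n) lamE (lab_lt n)"
  unfolding EW_labeling_def
proof (intro conjI rank_two_switching_WP)
  show "ER_labeling (WP n) (wle n) lamE (lab_lt n)"
    unfolding ER_labeling_def
  proof (intro ballI impI)
    fix x y assume xy: "x \<in> WP n" "y \<in> WP n" "wle n x y"
    obtain c where "satchain (WP n) (wle n) x y c" "successively (lab_lt n) (lword lamE c)"
      using increasing_chain_WP_exists[OF xy(1,2) wle_imp_wbelow[OF xy(3)]] by blast
    then show "\<exists>!c. satchain (WP n) (wle n) x y c \<and> successively (lab_lt n) (lword lamE c)"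
      using increasing_chain_WP_unique by (intro ex1I[of _ c]) blast+
  qed
  show "\<forall>x\<in>WP n. \<forall>y\<in>WP n. wle n x y \<longrightarrow>
      (\<forall>c1 c2. satchain (WP n) (wle n) x y c1 \<longrightarrow> satchain (WP n) (wle n) x y c2 \<longrightarrow>
         lword lamE c1 = lword lamE c2 \<longrightarrow> c1 = c2)"
    using lword_WP_inj by blast
qed

interpretation WP: EW_poset "WP n" "wle n" "wbot n" "wrank n" "lab_lt n" lamE for n
  by unfold_locales (rule EW_labeling_WP)

theorem theorem5p21:
  fixes n :: nat
  assumes "1 \<le> n"
  shows "EW_labeling (WP n) (wle n) (wbot n) lamE (lab_lt n) \<and>
         whitney_duals (WP n) (wle n) (wbot n)
           (Qcar (WP n) (wle n) (wbot n) lamE (lab_lt n))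
           (Qle (WP n) (wle n) (wbot n) lamE (lab_lt n))
           (Qbot (WP n) (wle n) (wbot n) lamE (lab_lt n))"
  using EW_labeling_WP WP.whitney_duals by blast

end
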